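(* Let $0<\alpha<n$, $\frac{n}{n-\alpha}<r<\infty$, and $1<p<q<\infty$ with $\frac1p-\frac1q=\frac{\alpha}{n}$. For measurable $F$ on $\mathbb{R}^{n+1}_+$ set $\mathcal{I}_\alpha(F)(x,t)=\mathcal{I}_\alpha(F(\cdot,t))(x)$ and $\mathcal{M}_\alpha(F)(x,t)=\mathcal{M}_\alpha(F(\cdot,t))(x)$. Then $\mathcal{I}_\alpha$ and $\mathcal{M}_\alpha$ are bounded from $T^p_r$ to $T^q_r$, i.e. $\|\mathcal{A}_r(\mathcal{I}_\alpha F)\|_{L^q}+\|\mathcal{A}_r(\mathcal{M}_\alpha F)\|_{L^q}\lesssim\|\mathcal{A}_rF\|_{L^p}$ for $F\in T^p_r$.
   Context: $\mathcal{I}_\alpha(f)(x)=\frac{1}{\gamma(\alpha)}\int_{\mathbb{R}^n}\frac{f(z)}{|x-z|^{n-\alpha}}\,dz$ with $\gamma(\alpha)=\pi^{n/2}2^\alpha\Gamma(\alpha/2)/\Gamma(\frac{n-\alpha}{2})$ (Riesz potential); $\mathcal{M}_\alpha(f)(x)=\sup_{\tau>0}\tau^{\alpha/n}\frac{1}{|B(x,\tau)|}\int_{B(x,\tau)}|f(y)|\,dy$ (fractional maximal function). $\mathcal{A}_r(F)(x)=\left(\int_0^\infty\int_{B(x,t)}|F(y,t)|^r\frac{dy\,dt}{t^{n+1}}\right)^{1/r}$ and $T^q_r=\{F \text{ measurable on } \mathbb{R}^n\times(0,\infty):\mathcal{A}_rF\in L^q(\mathbb{R}^n)\}$ with norm 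$\|\mathcal{A}_rF\|_{L^q}$.
   Formalization: The weight τ^{α/n} in the fractional maximal function M_α is replaced by |B(x,τ)|^{α/n} (a constant times τ^α), because for n≥2 the bound with τ^{α/n} fails under the dilation F(λx,λt); for n=1 the two agree up to a constant. *)

theory Defs
  imports "HOL-Analysis.Analysis"
begin

text \<open>Real powers of extended nonnegative reals (used only with positive exponents):
  infinity stays infinity.\<close>
definition enn_powr :: "ennreal \<Rightarrow> real \<Rightarrow> ennreal" where
  "enn_powr x s = (if x = \<infinity> then \<infinity> else ennreal (enn2real x powr s))"

definition Lq_norm :: "real \<Rightarrow> ('a::euclidean_space \<Rightarrow> ennreal) \<Rightarrow> ennreal" where
  "Lq_norm q g = enn_powr (\<integral>\<^sup>+ x. enn_powr (g x) q \<partial>lebesgue) (1 / q)"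

definition riesz_gamma :: "'a::euclidean_space itself \<Rightarrow> real \<Rightarrow> real" where
  "riesz_gamma _ \<alpha> = pi powr (real DIM('a) / 2) * 2 powr \<alpha> * Gamma (\<alpha> / 2)
      / Gamma ((real DIM('a) - \<alpha>) / 2)"

definition riesz_pot :: "real \<Rightarrow> ('a::euclidean_space \<Rightarrow> real) \<Rightarrow> 'a \<Rightarrow> real" where
  "riesz_pot \<alpha> f x = (1 / riesz_gamma TYPE('a) \<alpha>) *
      (\<integral>z. f z / norm (x - z) powr (real DIM('a) - \<alpha>) \<partial>lebesgue)"

definition frac_max :: "real \<Rightarrow> ('a::euclidean_space \<Rightarrow> real) \<Rightarrow> 'a \<Rightarrow> ennreal" where
  "frac_max \<alpha> f x = (SUP \<tau>\<in>{0<..}.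
      ennreal (measure lebesgue (ball x \<tau>) powr (\<alpha> / real DIM('a)) / measure lebesgue (ball x \<tau>))
      * (\<integral>\<^sup>+ y\<in>ball x \<tau>. ennreal \<bar>f y\<bar> \<partial>lebesgue))"

definition area_fun :: "real \<Rightarrow> ('a::euclidean_space \<Rightarrow> real \<Rightarrow> ennreal) \<Rightarrow> 'a \<Rightarrow> ennreal" where
  "area_fun r G x = enn_powr
     (\<integral>\<^sup>+ t\<in>{0<..}. (\<integral>\<^sup>+ y\<in>ball x t. enn_powr (G y t) r / ennreal (t ^ (DIM('a) + 1)) \<partial>lebesgue) \<partial>lebesgue)
     (1 / r)"

end

theory Submission
  imports Defs
begin

text \<open>Both operators are dominated by the positive operator $J f(x) = \int |x-z|^{\alpha-n} f(z)\,dz$.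
  Writing $A F$ for the area function, the pointwise bound $A(JF)(x) \le C\, J(AF)(x)$ holds: insert
  $1 = |B(z,t)|^{-1} \int 1_{|z-w|<t}\,dw$ into $J F(y,t)$ and apply Minkowski's integral
  inequality in $L^r$ of the cone over $x$; for $|x-y|<t$ and $|z-w|<t$ the kernel $|y-z|^{\alpha-n}$
  is comparable on average with $|x-w|^{\alpha-n}$. This reduces the theorem to the
  Hardy--Littlewood--Sobolev inequality for $J$ on functions of $x$ alone.\<close>

section \<open>Powers of extended nonnegative reals\<close>

text \<open>Since r > n/(n-alpha), the power |y-z|^{(alpha-n) r} is not locally integrable, so an
  L^r norm of the kernel over the cone cannot be taken. The kernel has to stay at its first power,
  as in Schur's test: Young's inequality is applied under the integral against |y-z|^{alpha-n}, and
  the kernel is then averaged over z in B(w,t) in one term and over y in B(x,t) in the other.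
  Averaging is unavoidable, because |y-z| may vanish while |x-w| is of order t. The weight in
  Young's inequality is a power of the area function a = AF itself, a(w)^{1-r}: its product with
  a(w)^r, the cone integral of |F|^r over w, is again a(w), so both terms end in J(a)(x). Hoelder's
  inequality and interpolation are likewise replaced by pointwise splittings, which keeps everything
  in [0, infinity] and spares dual exponents.\<close>

lemma enn_powr_ennreal: "0 \<le> x \<Longrightarrow> enn_powr (ennreal x) s = ennreal (x powr s)"
  by (simp add: enn_powr_def)

lemma enn_powr_top [simp]: "enn_powr top s = top"
  by (simp add: enn_powr_def)

lemma enn_powr_0 [simp]: "enn_powr 0 s = 0"
  by (simp add: enn_powr_def)

lemma enn_powr_eq_0_iff [simp]: "enn_powr x s = 0 \<longleftrightarrow> x = 0"
  by (cases x) (auto simp: enn_powr_ennreal)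

lemma enn_powr_one [simp]: "enn_powr x 1 = x"
  by (cases x) (auto simp: enn_powr_ennreal)

lemma enn_powr_mono: "x \<le> y \<Longrightarrow> 0 \<le> s \<Longrightarrow> enn_powr x s \<le> enn_powr y s"
  by (cases x; cases y) (auto simp: enn_powr_ennreal top_unique intro!: ennreal_leI powr_mono2)

text \<open>No sign condition on \<open>s\<close>: the power fixes both 0 and infinity, so the
  convention 0 * infinity = 0 is respected.\<close>

lemma enn_powr_mult: "enn_powr (x * y) s = enn_powr x s * enn_powr y s"
proof (cases x; cases y)
  fix a b assume "0 \<le> a" "x = ennreal a" "0 \<le> b" "y = ennreal b"
  then show ?thesis
    by (simp add: enn_powr_ennreal powr_mult flip: ennreal_mult)
next
  fix a assume "0 \<le> a" "x = ennreal a" "y = top"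
  then show ?thesis by (cases "a = 0") (simp_all add: enn_powr_ennreal ennreal_mult_top)
next
  fix b assume "0 \<le> b" "x = top" "y = ennreal b"
  then show ?thesis by (cases "b = 0") (simp_all add: enn_powr_ennreal ennreal_top_mult)
next
  assume "x = top" "y = top"
  then show ?thesis by simp
qed

lemma enn_powr_powr: "enn_powr (enn_powr x a) b = enn_powr x (a * b)"
  by (cases x) (auto simp: enn_powr_ennreal powr_powr)

lemma enn_powr_add_exponent: "enn_powr x a * enn_powr x b = enn_powr x (a + b)"
  by (cases x) (auto simp: enn_powr_ennreal powr_add simp flip: ennreal_mult)

lemma borel_measurable_enn_powr [measurable]:
  assumes [measurable]: "f \<in> borel_measurable M"
  shows "(\<lambda>x. enn_powr (f x) s) \<in> borel_measurable M"
  unfolding enn_powr_def by measurable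

section \<open>Radial integrals\<close>

text \<open>On the k-th shell the integrand is at most rho_k^{-beta}, and enlarging the shell to the
  ball of radius 2 rho_k costs only 2^n in volume, so a geometric series of ratio sigma^{n-beta}
  remains. The ratio is a parameter so that shrinking shells (sigma = 1/2, beta < n) and growing
  ones (sigma = 2, beta > n) share one argument. The centre z = x contributes 0, as powers of 0 are
  0.\<close>

lemma nn_integral_shells_powr:
  fixes x :: "'a::euclidean_space" and \<beta> c \<sigma> :: real
  assumes \<beta>: "0 < \<beta>" and c: "0 < c" and \<sigma>: "0 < \<sigma>" "\<sigma> powr (real DIM('a) - \<beta>) < 1"
    and S: "\<And>z. z \<in> S \<Longrightarrow> z \<noteq> x \<Longrightarrow> \<exists>k. c * \<sigma> ^ k \<le> norm (x - z) \<and> norm (x - z) < 2 * (c * \<sigma> ^ k)"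
  shows "(\<integral>\<^sup>+z. indicator S z * ennreal (norm (x - z) powr - \<beta>) \<partial>lborel)
    \<le> ennreal (unit_ball_vol DIM('a) * 2 ^ DIM('a) / (1 - \<sigma> powr (DIM('a) - \<beta>)) * c powr (DIM('a) - \<beta>))"
proof -
  let ?n = "DIM('a)"
  define \<rho> where "\<rho> k = c * \<sigma> ^ k" for k :: nat
  define V where "V = unit_ball_vol (real ?n) * 2 ^ ?n"
  have \<rho>: "0 < \<rho> k" for k using c \<sigma> by (simp add: \<rho>_def)
  have V: "0 \<le> V" by (simp add: V_def)
  have \<rho>_powr: "\<rho> k powr e = c powr e * (\<sigma> powr e) ^ k" for k e
    using c \<sigma> by (simp add: \<rho>_def powr_mult powr_power powr_powr mult.commute powr_realpow[symmetric])
  have "(\<integral>\<^sup>+z. indicator S z * ennreal (norm (x - z) powr - \<beta>) \<partial>lborel)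
    \<le> (\<integral>\<^sup>+z. (\<Sum>k. ennreal (\<rho> k powr - \<beta>) * indicator (ball x (2 * \<rho> k)) z) \<partial>lborel)"
  proof (rule nn_integral_mono)
    fix z :: 'a
    show "indicator S z * ennreal (norm (x - z) powr - \<beta>) \<le> (\<Sum>k. ennreal (\<rho> k powr - \<beta>) * indicator (ball x (2 * \<rho> k)) z)"
    proof (cases "z \<in> S \<and> z \<noteq> x")
      case True
      then obtain k where k: "\<rho> k \<le> norm (x - z)" "norm (x - z) < 2 * \<rho> k"
        using S unfolding \<rho>_def by blast
      have "indicator S z * ennreal (norm (x - z) powr - \<beta>) \<le> ennreal (\<rho> k powr - \<beta>) * indicator (ball x (2 * \<rho> k)) z"
        using True k \<rho>[of k] \<beta> by (auto simp: dist_norm intro!: ennreal_leI powr_mono2')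
      also have "\<dots> \<le> (\<Sum>k. ennreal (\<rho> k powr - \<beta>) * indicator (ball x (2 * \<rho> k)) z)"
        using sum_le_suminf[of "\<lambda>k. ennreal (\<rho> k powr - \<beta>) * indicator (ball x (2 * \<rho> k)) z" "{k}"]
        by (simp del: sum_mult_indicator sum_indicator_mult)
      finally show ?thesis .
    qed (auto simp: indicator_def)
  qed
  also have "\<dots> = (\<Sum>k. ennreal (\<rho> k powr - \<beta>) * emeasure lborel (ball x (2 * \<rho> k)))"
  proof -
    have "(\<lambda>z. ennreal (\<rho> k powr - \<beta>) * indicator (ball x (2 * \<rho> k)) z) \<in> borel_measurable lborel" for k
      by (intro borel_measurable_times_ennreal borel_measurable_const borel_measurable_indicator) simp
    then show ?thesis
      by (subst nn_integral_suminf) (simp_all only: nn_integral_cmult_indicator sets_lborel open_ball borel_open)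
  qed
  also have "\<dots> = (\<Sum>k. ennreal (V * c powr (?n - \<beta>) * (\<sigma> powr (?n - \<beta>)) ^ k))"
  proof (rule suminf_cong)
    fix k
    have "\<rho> k powr - \<beta> * \<rho> k ^ ?n = c powr (?n - \<beta>) * (\<sigma> powr (?n - \<beta>)) ^ k"
      unfolding \<rho>_powr[symmetric] using \<rho>[of k]
      by (subst powr_realpow[symmetric]) (simp_all add: powr_add[symmetric])
    then have "\<rho> k powr - \<beta> * (unit_ball_vol ?n * (2 * \<rho> k) ^ ?n) = V * c powr (?n - \<beta>) * (\<sigma> powr (?n - \<beta>)) ^ k"
      by (simp add: V_def power_mult_distrib mult_ac)
    then show "ennreal (\<rho> k powr - \<beta>) * emeasure lborel (ball x (2 * \<rho> k)) = ennreal (V * c powr (?n - \<beta>) * (\<sigma> powr (?n - \<beta>)) ^ k)"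
      using \<rho>[of k] by (simp add: emeasure_ball flip: ennreal_mult)
  qed
  also have "\<dots> = ennreal (\<Sum>k. V * c powr (?n - \<beta>) * (\<sigma> powr (?n - \<beta>)) ^ k)"
    using \<sigma> V by (intro suminf_ennreal2) (auto intro!: summable_mult summable_geometric)
  also have "(\<Sum>k. V * c powr (?n - \<beta>) * (\<sigma> powr (?n - \<beta>)) ^ k) = V / (1 - \<sigma> powr (?n - \<beta>)) * c powr (?n - \<beta>)"
    using \<sigma> by (subst suminf_mult) (auto simp: suminf_geometric summable_geometric)
  finally show ?thesis by (simp add: V_def)
qed

lemma nn_integral_powr_near:
  fixes \<beta> :: real
  assumes "0 < \<beta>" "\<beta> < real DIM('a::euclidean_space)"
  shows "\<exists>C>0. \<forall>(x::'a) R. 0 < R \<longrightarrow>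
    (\<integral>\<^sup>+z. indicator (ball x R) z * ennreal (norm (x - z) powr - \<beta>) \<partial>lborel) \<le> ennreal (C * R powr (DIM('a) - \<beta>))"
proof -
  let ?n = "DIM('a)"
  define C where "C = unit_ball_vol ?n * 2 ^ ?n / (1 - (1/2) powr (?n - \<beta>)) * (1/2) powr (?n - \<beta>)"
  have lt: "(1/2) powr (?n - \<beta>) < (1::real)"
    using assms by (subst powr01_less_one) auto
  have "0 < C" using lt unfolding C_def by (intro mult_pos_pos divide_pos_pos) auto
  moreover have "(\<integral>\<^sup>+z. indicator (ball x R) z * ennreal (norm (x - z) powr - \<beta>) \<partial>lborel) \<le> ennreal (C * R powr (?n - \<beta>))"
    if "0 < R" for x :: 'a and R
  proof -
    have "\<exists>k. R/2 * (1/2) ^ k \<le> norm (x - z) \<and> norm (x - z) < 2 * (R/2 * (1/2) ^ k)"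
      if "z \<in> ball x R" "z \<noteq> x" for z
    proof -
      \<comment> \<open>The first dyadic scale not exceeding |x-z| works: its minimality supplies
        the upper bound, and for scale 0 membership in the ball does. Starting from R/2 makes the
        outermost shell end at R, whence the factor (1/2)^{n-beta} in \<open>C\<close>.\<close>
      let ?P = "\<lambda>k::nat. R/2 * (1/2) ^ k \<le> norm (x - z)"
      have d: "0 < norm (x - z)" "norm (x - z) < R" using that by (auto simp: dist_norm)
      obtain k where "(1/2) ^ k < norm (x - z) / (R/2)"
        using real_arch_pow_inv[of "norm (x - z) / (R/2)" "1/2"] d \<open>0 < R\<close> by auto
      then have "?P k" using \<open>0 < R\<close> by (simp add: field_simps)
      then have P: "?P (LEAST k. ?P k)" by (rule LeastI)
      show ?thesis
      proof (intro exI conjI)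
        show "?P (LEAST k. ?P k)" by fact
        show "norm (x - z) < 2 * (R/2 * (1/2) ^ (LEAST k. ?P k))"
        proof (cases "LEAST k. ?P k")
          case 0
          then show ?thesis using d by simp
        next
          case (Suc j)
          then have "\<not> ?P j" by (metis lessI not_less_Least)
          then show ?thesis unfolding Suc by simp
        qed
      qed
    qed
    then show ?thesis
      using nn_integral_shells_powr[OF assms(1) _ _ lt, of "R/2" "ball x R" x] \<open>0 < R\<close>
      by (simp add: C_def powr_mult powr_divide mult_ac)
  qed
  ultimately show ?thesis by blast
qed

text \<open>The mirror image of the near case: shells grow outward from R, and now the least k is
  taken for the upper bound, its minimality giving the lower one.\<close>

lemma nn_integral_powr_far:
  fixes \<beta> :: real
  assumes "real DIM('a::euclidean_space) < \<beta>"
  shows "\<exists>C>0. \<forall>(x::'a) R. 0 < R \<longrightarrow>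
    (\<integral>\<^sup>+z. indicator (- ball x R) z * ennreal (norm (x - z) powr - \<beta>) \<partial>lborel) \<le> ennreal (C * R powr (DIM('a) - \<beta>))"
proof -
  let ?n = "DIM('a)"
  define C where "C = unit_ball_vol ?n * 2 ^ ?n / (1 - 2 powr (?n - \<beta>))"
  have lt: "2 powr (?n - \<beta>) < (1::real)"
    using assms by (simp add: powr_less_one)
  have "0 < C" using lt unfolding C_def by (intro mult_pos_pos divide_pos_pos) auto
  moreover have "(\<integral>\<^sup>+z. indicator (- ball x R) z * ennreal (norm (x - z) powr - \<beta>) \<partial>lborel) \<le> ennreal (C * R powr (?n - \<beta>))"
    if "0 < R" for x :: 'a and R
  proof -
    have "\<exists>k. R * 2 ^ k \<le> norm (x - z) \<and> norm (x - z) < 2 * (R * 2 ^ k)"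
      if "z \<in> - ball x R" for z
    proof -
      let ?P = "\<lambda>k::nat. norm (x - z) < 2 * (R * 2 ^ k)"
      have d: "R \<le> norm (x - z)" using that by (auto simp: dist_norm)
      obtain k where "norm (x - z) / (2*R) < 2 ^ k"
        using real_arch_pow[of 2 "norm (x - z) / (2*R)"] by auto
      then have "?P k" using \<open>0 < R\<close> by (simp add: field_simps)
      then have P: "?P (LEAST k. ?P k)" by (rule LeastI)
      show ?thesis
      proof (intro exI conjI)
        show "?P (LEAST k. ?P k)" by fact
        show "R * 2 ^ (LEAST k. ?P k) \<le> norm (x - z)"
        proof (cases "LEAST k. ?P k")
          case 0
          then show ?thesis using d by simp
        next
          case (Suc j)
          then have "\<not> ?P j" by (metis lessI not_less_Least)
          then show ?thesis unfolding Suc by simp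
        qed
      qed
    qed
    then show ?thesis
      using nn_integral_shells_powr[OF _ that _ lt, of "- ball x R" x] assms by (simp add: C_def)
  qed
  ultimately show ?thesis by blast
qed

section \<open>Comparison and layer cake formula for extended nonnegative reals\<close>

text \<open>Replaces X by arbitrary finite c > 0 above it, so that later proofs may divide by c
  although X itself may be 0 or infinite. The case X = 0 is reached by letting c tend to 0.\<close>

lemma ennreal_le_multI:
  assumes "0 < D" and le: "\<And>c. 0 < c \<Longrightarrow> X \<le> ennreal c \<Longrightarrow> Y \<le> ennreal (D * c)"
  shows "Y \<le> ennreal D * X"
proof (cases X)
  case (real x)
  show ?thesis
  proof (rule ennreal_le_epsilon)
    fix e :: real assume "0 < e"
    have "Y \<le> ennreal (D * (x + e / D))"
      using real \<open>0 < e\<close> \<open>0 < D\<close> by (intro le) (auto intro!: add_nonneg_pos ennreal_leI)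
    also have "D * (x + e / D) = D * x + e"
      using \<open>0 < D\<close> by (simp add: field_simps)
    also have "ennreal (D * x + e) = ennreal D * X + ennreal e"
      using real \<open>0 < e\<close> \<open>0 < D\<close> by (simp add: ennreal_mult)
    finally show "Y \<le> ennreal D * X + ennreal e" .
  qed
qed (use \<open>0 < D\<close> in \<open>simp add: ennreal_mult_top\<close>)

text \<open>A crude Young inequality, the substitute for Hoelder's: a value above the height k
  satisfies u = u^{1-p} u^p with u^{1-p} <= k^{1-p}.\<close>

lemma ennreal_le_powr_add:
  assumes "0 < k" "1 \<le> p"
  shows "u \<le> ennreal (k powr (1 - p)) * enn_powr u p + ennreal k"
proof (cases u)
  case (real v)
  show ?thesis
  proof (cases "v \<le> k")
    case True
    then have "u \<le> ennreal k" using real by (simp add: ennreal_leI)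
    then show ?thesis by (simp add: add_increasing)
  next
    case False
    then have "0 < v" using \<open>0 < k\<close> by simp
    then have "v = v powr (1 - p) * v powr p" by (simp flip: powr_add)
    also have "\<dots> \<le> k powr (1 - p) * v powr p"
      using False assms by (intro mult_right_mono powr_mono2') auto
    finally have "u \<le> ennreal (k powr (1 - p)) * enn_powr u p"
      using real by (simp add: enn_powr_ennreal ennreal_leI flip: ennreal_mult)
    then show ?thesis by (simp add: add_increasing2)
  qed
qed (use assms in \<open>simp add: ennreal_mult_top\<close>)

text \<open>The condition on l sits inside the integrand so that Tonelli's theorem can later
  exchange l with the variable of g. For infinite g the integral exceeds each m, by comparison with
  the finite level m^{1/theta}.\<close>

lemma enn_powr_layer_cake:
  assumes "0 < \<theta>"
  shows "(\<integral>\<^sup>+l. (if 0 < l \<and> ennreal l < g then ennreal (\<theta> * l powr (\<theta> - 1)) else 0) \<partial>lborel) = enn_powr g \<theta>"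
proof -
  have fin: "(\<integral>\<^sup>+l. (if 0 < l \<and> l < B then ennreal (\<theta> * l powr (\<theta> - 1)) else 0) \<partial>lborel) = ennreal (B powr \<theta>)"
    if "0 \<le> B" for B
  proof -
    have "((\<lambda>l. \<theta> * l powr (\<theta> - 1)) has_integral (\<theta> * (B powr (\<theta> - 1 + 1) / (\<theta> - 1 + 1)))) {0..B}"
      using assms that by (intro has_integral_mult_right has_integral_powr_from_0) auto
    then have "(\<integral>\<^sup>+l. ennreal (indicator {0..B} l * (\<theta> * l powr (\<theta> - 1))) \<partial>lborel) = ennreal (B powr \<theta>)"
      using assms by (subst nn_integral_has_integral_lebesgue) auto
    moreover have "AE l in lborel. l \<noteq> 0 \<and> l \<noteq> B"
      by (intro AE_conjI AE_lborel_singleton)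
    then have "AE l in lborel. (if 0 < l \<and> l < B then ennreal (\<theta> * l powr (\<theta> - 1)) else 0)
        = ennreal (indicator {0..B} l * (\<theta> * l powr (\<theta> - 1)))"
      by eventually_elim (auto simp: indicator_def)
    ultimately show ?thesis by (simp add: nn_integral_cong_AE)
  qed
  show ?thesis
  proof (cases g)
    case (real B)
    then have "(0 < l \<and> ennreal l < g) = (0 < l \<and> l < B)" for l
      by (auto simp: ennreal_less_iff)
    then show ?thesis using fin[of B] real by (simp add: enn_powr_ennreal)
  next
    case top
    have "of_nat m \<le> (\<integral>\<^sup>+l. (if 0 < l \<and> ennreal l < g then ennreal (\<theta> * l powr (\<theta> - 1)) else 0) \<partial>lborel)" for m :: nat
    proof -
      have "of_nat m = ennreal ((real m powr (1/\<theta>)) powr \<theta>)"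
        using assms by (simp add: powr_powr ennreal_of_nat_eq_real_of_nat)
      also have "\<dots> = (\<integral>\<^sup>+l. (if 0 < l \<and> l < real m powr (1/\<theta>) then ennreal (\<theta> * l powr (\<theta> - 1)) else 0) \<partial>lborel)"
        by (rule fin[symmetric]) simp
      also have "\<dots> \<le> (\<integral>\<^sup>+l. (if 0 < l \<and> ennreal l < g then ennreal (\<theta> * l powr (\<theta> - 1)) else 0) \<partial>lborel)"
        using top by (intro nn_integral_mono) auto
      finally show ?thesis .
    qed
    then have "(SUP m::nat. of_nat m) \<le> (\<integral>\<^sup>+l. (if 0 < l \<and> ennreal l < g then ennreal (\<theta> * l powr (\<theta> - 1)) else 0) \<partial>lborel)"
      by (intro SUP_least)
    then show ?thesis using top by (simp add: ennreal_SUP_of_nat_eq_top top_unique)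
  qed
qed

lemma borel_measurable_indicator_ball [measurable]:
  fixes f g :: "'b \<Rightarrow> 'a::euclidean_space"
  assumes [measurable]: "f \<in> borel_measurable M" "g \<in> borel_measurable M" "h \<in> borel_measurable M"
  shows "(\<lambda>w. indicator (ball (f w) (h w)) (g w) :: ennreal) \<in> borel_measurable M"
proof -
  have "(\<lambda>w. indicator (ball (f w) (h w)) (g w) :: ennreal) = (\<lambda>w. if dist (f w) (g w) < h w then 1 else 0)"
    by (auto simp: indicator_def)
  then show ?thesis by simp
qed

section \<open>The Riesz kernel\<close>

text \<open>On the diagonal the value is 0, not infinity, because powers of 0 are 0. Lower bounds on
  the kernel therefore exclude coinciding points and are used almost everywhere.\<close>

definition riesz_kernel :: "real \<Rightarrow> 'a::euclidean_space \<Rightarrow> 'a \<Rightarrow> ennreal" where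
  "riesz_kernel \<alpha> x z = ennreal (norm (x - z) powr (\<alpha> - DIM('a)))"

definition riesz_op :: "real \<Rightarrow> ('a::euclidean_space \<Rightarrow> ennreal) \<Rightarrow> 'a \<Rightarrow> ennreal" where
  "riesz_op \<alpha> f x = (\<integral>\<^sup>+z. riesz_kernel \<alpha> x z * f z \<partial>lborel)"

lemma riesz_kernel_commute: "riesz_kernel \<alpha> x z = riesz_kernel \<alpha> z x"
  by (simp add: riesz_kernel_def norm_minus_commute)

lemma borel_measurable_riesz_kernel [measurable]:
  fixes f g :: "'b \<Rightarrow> 'a::euclidean_space"
  assumes [measurable]: "f \<in> borel_measurable M" "g \<in> borel_measurable M"
  shows "(\<lambda>w. riesz_kernel \<alpha> (f w) (g w)) \<in> borel_measurable M"
  unfolding riesz_kernel_def by measurable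

lemma borel_measurable_riesz_op [measurable]:
  fixes f :: "'a::euclidean_space \<Rightarrow> ennreal"
  assumes [measurable]: "f \<in> borel_measurable borel"
  shows "riesz_op \<alpha> f \<in> borel_measurable borel"
  unfolding riesz_op_def by measurable

lemma riesz_kernel_near:
  assumes "0 < \<alpha>" "\<alpha> < real DIM('a::euclidean_space)"
  obtains C where "0 < C" "\<And>(x::'a) R. 0 < R \<Longrightarrow>
    (\<integral>\<^sup>+z. indicator (ball x R) z * riesz_kernel \<alpha> x z \<partial>lborel) \<le> ennreal (C * R powr \<alpha>)"
proof -
  obtain C where "C > 0" "\<And>(x::'a) R. 0 < R \<Longrightarrow>
    (\<integral>\<^sup>+z. indicator (ball x R) z * ennreal (norm (x - z) powr - (DIM('a) - \<alpha>)) \<partial>lborel)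
      \<le> ennreal (C * R powr (DIM('a) - (DIM('a) - \<alpha>)))"
    using nn_integral_powr_near[of "DIM('a) - \<alpha>", where 'a='a] assms by auto
  then show thesis by (intro that[of C]) (simp_all add: riesz_kernel_def)
qed

text \<open>Instead of Hoelder's inequality, f is split at a height that decreases with the distance
  to x. One piece is paid for by the p-th power integral of f, which gives the 1 in the constant,
  the other by the tail of a power, which gives C.\<close>

lemma riesz_op_far:
  assumes \<alpha>: "0 < \<alpha>" "\<alpha> < real DIM('a::euclidean_space)"
    and pq: "1 < p" "p < q" "1 / p - 1 / q = \<alpha> / DIM('a)"
  obtains C where "0 < C" "\<And>(f::'a \<Rightarrow> ennreal) x R. f \<in> borel_measurable borel \<Longrightarrow>
      (\<integral>\<^sup>+z. enn_powr (f z) p \<partial>lborel) \<le> 1 \<Longrightarrow> 0 < R \<Longrightarrow>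
      (\<integral>\<^sup>+z. indicator (- ball x R) z * (riesz_kernel \<alpha> x z * f z) \<partial>lborel) \<le> ennreal (C * R powr - (DIM('a) / q))"
proof -
  let ?n = "real DIM('a)"
  have q: "0 < q" and n: "0 < ?n" using pq by auto
  have e1: "\<alpha> - ?n / p = - (?n / q)"
    using pq n by (simp add: field_simps)
  obtain C where C: "C > 0" "\<And>(x::'a) R. 0 < R \<Longrightarrow>
    (\<integral>\<^sup>+z. indicator (- ball x R) z * ennreal (norm (x - z) powr - (?n + ?n / q)) \<partial>lborel)
      \<le> ennreal (C * R powr (?n - (?n + ?n / q)))"
    using nn_integral_powr_far[of "?n + ?n / q", where 'a='a] q n by auto
  show thesis
  proof (rule that[of "1 + C"])
    fix f :: "'a \<Rightarrow> ennreal" and x and R :: real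
    assume f [measurable]: "f \<in> borel_measurable borel" and le1: "(\<integral>\<^sup>+z. enn_powr (f z) p \<partial>lborel) \<le> 1" and R: "0 < R"
    have "(\<integral>\<^sup>+z. indicator (- ball x R) z * (riesz_kernel \<alpha> x z * f z) \<partial>lborel)
      \<le> (\<integral>\<^sup>+z. ennreal (R powr - (?n / q)) * enn_powr (f z) p
          + indicator (- ball x R) z * ennreal (norm (x - z) powr - (?n + ?n / q)) \<partial>lborel)"
    proof (rule nn_integral_mono)
      fix z :: 'a
      define d where "d = norm (x - z)"
      show "indicator (- ball x R) z * (riesz_kernel \<alpha> x z * f z)
        \<le> ennreal (R powr - (?n / q)) * enn_powr (f z) p
          + indicator (- ball x R) z * ennreal (norm (x - z) powr - (?n + ?n / q))"
      proof (cases "z \<in> ball x R")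
        case False
        then have d: "R \<le> d" "0 < d" using R by (auto simp: d_def dist_norm)
        \<comment> \<open>With this height the coefficient of f^p becomes d^{alpha-n/p} = d^{-n/q},
          bounded by its value at R, while the remainder d^{-(n+n/q)} is integrable at infinity with
          tail of the same order R^{-n/q}.\<close>
        define k where "k = d powr - (?n / p)"
        have "0 < k" using d by (simp add: k_def)
        have "d powr (\<alpha> - ?n) * k powr (1 - p) = d powr - (?n / q)"
          using pq by (simp add: k_def powr_powr field_simps flip: powr_add e1)
        also have "\<dots> \<le> R powr - (?n / q)"
          using d R q n by (intro powr_mono2') auto
        finally have 1: "ennreal (d powr (\<alpha> - ?n)) * ennreal (k powr (1 - p)) \<le> ennreal (R powr - (?n / q))"
          by (simp flip: ennreal_mult)
        have 2: "d powr (\<alpha> - ?n) * k = d powr - (?n + ?n / q)"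
        proof -
          have "d powr (\<alpha> - ?n) * k = d powr (\<alpha> - ?n + - (?n / p))"
            by (simp only: k_def powr_add)
          also have "\<alpha> - ?n + - (?n / p) = - (?n + ?n / q)" using e1 by simp
          finally show ?thesis .
        qed
        have "riesz_kernel \<alpha> x z * f z \<le> ennreal (d powr (\<alpha> - ?n)) * (ennreal (k powr (1 - p)) * enn_powr (f z) p + ennreal k)"
          unfolding riesz_kernel_def d_def[symmetric]
          using pq d by (intro mult_left_mono ennreal_le_powr_add) (auto simp: k_def)
        also have "\<dots> = ennreal (d powr (\<alpha> - ?n)) * ennreal (k powr (1 - p)) * enn_powr (f z) p + ennreal (d powr - (?n + ?n / q))"
          unfolding 2[symmetric] using \<open>0 < k\<close> by (simp add: distrib_left mult.assoc ennreal_mult)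
        also have "\<dots> \<le> ennreal (R powr - (?n / q)) * enn_powr (f z) p + ennreal (d powr - (?n + ?n / q))"
          by (intro add_mono mult_right_mono 1) auto
        finally show ?thesis using False by (simp add: d_def)
      qed simp
    qed
    also have "\<dots> = ennreal (R powr - (?n / q)) * (\<integral>\<^sup>+z. enn_powr (f z) p \<partial>lborel)
        + (\<integral>\<^sup>+z. indicator (- ball x R) z * ennreal (norm (x - z) powr - (?n + ?n / q)) \<partial>lborel)"
      by (simp add: nn_integral_add nn_integral_cmult)
    also have "\<dots> \<le> ennreal (R powr - (?n / q)) * 1 + ennreal (C * R powr (?n - (?n + ?n / q)))"
      by (intro add_mono mult_left_mono le1 C R) auto
    also have "\<dots> = ennreal ((1 + C) * R powr - (?n / q))"
      using C by (simp add: distrib_right flip: ennreal_plus)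
    finally show "(\<integral>\<^sup>+z. indicator (- ball x R) z * (riesz_kernel \<alpha> x z * f z) \<partial>lborel) \<le> ennreal ((1 + C) * R powr - (?n / q))" .
  qed (use C in auto)
qed

section \<open>The Hardy--Littlewood--Sobolev inequality\<close>

text \<open>The kernel is split at distance $R \sim l^{-q/n}$ and $f$ at height $s \sim l^{q/p}$: the far part
  and the near part of the bounded piece each contribute at most $l/4$, so only the large values of
  $f$ matter and Chebyshev's inequality applies to them.\<close>

lemma riesz_op_level:
  assumes \<alpha>: "0 < \<alpha>" "\<alpha> < real DIM('a::euclidean_space)"
    and pq: "1 < p" "p < q" "1 / p - 1 / q = \<alpha> / DIM('a)"
  obtains C c where "0 < C" "0 < c" "\<And>(f::'a \<Rightarrow> ennreal) l. f \<in> borel_measurable borel \<Longrightarrow>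
      (\<integral>\<^sup>+z. enn_powr (f z) p \<partial>lborel) \<le> 1 \<Longrightarrow> 0 < l \<Longrightarrow>
      emeasure lborel {x. ennreal l < riesz_op \<alpha> f x} \<le>
        ennreal (C * l powr - (q / p)) * (\<integral>\<^sup>+z. (if ennreal (c * l powr (q / p)) < f z then f z else 0) \<partial>lborel)"
proof -
  let ?n = "real DIM('a)"
  have q: "0 < q" and n: "0 < ?n" using pq by auto
  \<comment> \<open>The scaling relation: it turns R^alpha, for R of order l^{-q/n}, into a multiple
    of l^{1-q/p}.\<close>
  have e: "q * \<alpha> / ?n = q / p - 1"
    using pq q n by (simp add: field_simps)
  obtain A where A: "0 < A" "\<And>(x::'a) R. 0 < R \<Longrightarrow>
    (\<integral>\<^sup>+z. indicator (ball x R) z * riesz_kernel \<alpha> x z \<partial>lborel) \<le> ennreal (A * R powr \<alpha>)"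
    using riesz_kernel_near[OF \<alpha>] by blast
  obtain B where B: "0 < B" "\<And>(f::'a \<Rightarrow> ennreal) x R. f \<in> borel_measurable borel \<Longrightarrow>
      (\<integral>\<^sup>+z. enn_powr (f z) p \<partial>lborel) \<le> 1 \<Longrightarrow> 0 < R \<Longrightarrow>
      (\<integral>\<^sup>+z. indicator (- ball x R) z * (riesz_kernel \<alpha> x z * f z) \<partial>lborel) \<le> ennreal (B * R powr - (?n / q))"
    using riesz_op_far[OF \<alpha> pq] by blast
  define D where "D = (4 * B) powr (q / p - 1)"
  have D: "0 < D" using B by (simp add: D_def)
  show thesis
  proof (rule that[of "2 * A * D" "1 / (4 * A * D)"])
    fix f :: "'a \<Rightarrow> ennreal" and l :: real
    assume f [measurable]: "f \<in> borel_measurable borel" and le1: "(\<integral>\<^sup>+z. enn_powr (f z) p \<partial>lborel) \<le> 1" and l: "0 < l"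
    define R where "R = (l / (4 * B)) powr - (q / ?n)"
    have R: "0 < R" using l B by (simp add: R_def)
    have R1: "B * R powr - (?n / q) = l / 4"
      using l B q n by (simp add: R_def powr_powr)
    have R2: "R powr \<alpha> = D * l powr (1 - q / p)"
    proof -
      have "R powr \<alpha> = (l / (4 * B)) powr (1 - q / p)"
        using e by (simp add: R_def powr_powr mult.commute)
      also have "\<dots> = D * l powr (1 - q / p)"
        using l B by (simp add: D_def powr_divide powr_diff field_simps)
      finally show ?thesis .
    qed
    define s where "s = 1 / (4 * A * D) * l powr (q / p)"
    have s: "0 < s" using l A D by (simp add: s_def)
    have R3: "A * R powr \<alpha> * s = l / 4"
    proof -
      have "A * R powr \<alpha> * s = (l powr (1 - q / p) * l powr (q / p)) / 4"
        using A D by (simp add: R2 s_def)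
      then show ?thesis using l by (simp flip: powr_add)
    qed
    have R4: "2 / l * (A * R powr \<alpha>) = 2 * A * D * l powr - (q / p)"
      using l by (simp add: R2 powr_diff powr_minus field_simps)
    have eq: "ennreal (2 * A * D * l powr - (q / p)) = ennreal (2 / l) * ennreal (A * R powr \<alpha>)"
      unfolding R4[symmetric] using l by (intro ennreal_mult') simp
    define g where "g z = (if ennreal s < f z then f z else 0)" for z
    have g [measurable]: "g \<in> borel_measurable borel" unfolding g_def by measurable
    define h where "h x = (\<integral>\<^sup>+z. indicator (ball x R) z * (riesz_kernel \<alpha> x z * g z) \<partial>lborel)" for x
    have h [measurable]: "h \<in> borel_measurable borel"
      unfolding h_def by measurable
    \<comment> \<open>On the level set the far part and the bounded near part use up at most l/2, so
      the near part h of the large values exceeds l/2. This is Chebyshev's inequality in pointwise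
      form, to be integrated in x.\<close>
    have le_h: "1 \<le> ennreal (2 / l) * h x" if "ennreal l < riesz_op \<alpha> f x" for x
    proof -
      have "riesz_op \<alpha> f x \<le> (\<integral>\<^sup>+z. indicator (- ball x R) z * (riesz_kernel \<alpha> x z * f z)
         + (indicator (ball x R) z * riesz_kernel \<alpha> x z) * ennreal s
         + indicator (ball x R) z * (riesz_kernel \<alpha> x z * g z) \<partial>lborel)"
        unfolding riesz_op_def
      proof (rule nn_integral_mono)
        fix z
        show "riesz_kernel \<alpha> x z * f z \<le> indicator (- ball x R) z * (riesz_kernel \<alpha> x z * f z)
         + (indicator (ball x R) z * riesz_kernel \<alpha> x z) * ennreal s
         + indicator (ball x R) z * (riesz_kernel \<alpha> x z * g z)"
          by (cases "z \<in> ball x R"; cases "ennreal s < f z") (auto simp: g_def not_less intro!: mult_left_mono add_increasing)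
      qed
      also have "\<dots> = (\<integral>\<^sup>+z. indicator (- ball x R) z * (riesz_kernel \<alpha> x z * f z) \<partial>lborel)
         + (\<integral>\<^sup>+z. indicator (ball x R) z * riesz_kernel \<alpha> x z \<partial>lborel) * ennreal s + h x"
        unfolding h_def by (simp add: nn_integral_add nn_integral_multc)
      also have "\<dots> \<le> ennreal (l / 4) + ennreal (A * R powr \<alpha>) * ennreal s + h x"
        unfolding R1[symmetric] by (intro add_mono mult_right_mono A B f le1 R order_refl) auto
      also have "\<dots> = ennreal (l / 2) + h x"
        using A s l by (simp add: R3 flip: ennreal_mult ennreal_plus)
      finally have "ennreal l < ennreal (l / 2) + h x" using that by simp
      then have "ennreal (l / 2) + ennreal (l / 2) < ennreal (l / 2) + h x"
        using l by (simp flip: ennreal_plus)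
      then have "ennreal (l / 2) < h x" by (simp only: ennreal_add_left_cancel_less)
      then have "ennreal (2 / l) * ennreal (l / 2) \<le> ennreal (2 / l) * h x"
        by (intro mult_left_mono) auto
      then show ?thesis using l by (simp flip: ennreal_mult)
    qed
    have "(\<integral>\<^sup>+x. h x \<partial>lborel) = (\<integral>\<^sup>+z. (\<integral>\<^sup>+x. indicator (ball x R) z * (riesz_kernel \<alpha> x z * g z) \<partial>lborel) \<partial>lborel)"
      unfolding h_def by (rule lborel_pair.Fubini') measurable
    \<comment> \<open>Ball and kernel are symmetric in x and z, so the inner integral is the local
      kernel integral around z, bounded uniformly in z.\<close>
    also have "\<dots> = (\<integral>\<^sup>+z. (\<integral>\<^sup>+x. indicator (ball z R) x * riesz_kernel \<alpha> z x \<partial>lborel) * g z \<partial>lborel)"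
      by (intro nn_integral_cong, subst nn_integral_multc[symmetric])
        (auto simp: riesz_kernel_commute indicator_def dist_commute intro!: nn_integral_cong)
    also have "\<dots> \<le> (\<integral>\<^sup>+z. ennreal (A * R powr \<alpha>) * g z \<partial>lborel)"
      by (intro nn_integral_mono mult_right_mono A R) auto
    also have "\<dots> = ennreal (A * R powr \<alpha>) * (\<integral>\<^sup>+z. g z \<partial>lborel)"
      by (simp add: nn_integral_cmult)
    finally have int_h: "(\<integral>\<^sup>+x. h x \<partial>lborel) \<le> ennreal (A * R powr \<alpha>) * (\<integral>\<^sup>+z. g z \<partial>lborel)" .
    have "emeasure lborel {x. ennreal l < riesz_op \<alpha> f x} = (\<integral>\<^sup>+x. indicator {x. ennreal l < riesz_op \<alpha> f x} x \<partial>lborel)"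
      by simp
    also have "\<dots> \<le> (\<integral>\<^sup>+x. ennreal (2 / l) * h x \<partial>lborel)"
      using le_h by (intro nn_integral_mono) (auto simp: indicator_def)
    also have "\<dots> = ennreal (2 / l) * (\<integral>\<^sup>+x. h x \<partial>lborel)"
      by (simp add: nn_integral_cmult)
    also have "\<dots> \<le> ennreal (2 / l) * (ennreal (A * R powr \<alpha>) * (\<integral>\<^sup>+z. g z \<partial>lborel))"
      by (intro mult_left_mono int_h) auto
    finally show "emeasure lborel {x. ennreal l < riesz_op \<alpha> f x} \<le>
        ennreal (2 * A * D * l powr - (q / p)) *
        (\<integral>\<^sup>+z. (if ennreal (1 / (4 * A * D) * l powr (q / p)) < f z then f z else 0) \<partial>lborel)"
      unfolding eq g_def s_def by (simp only: mult.assoc)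
  qed (use A D in auto)
qed

text \<open>The level set estimate retains the truncated f instead of a mere power of l. Integrated
  against q l^{q-1}, with the order of integration exchanged, it gives the strong type bound at
  once: the mechanism of Marcinkiewicz interpolation without weak type endpoints.\<close>

lemma riesz_op_unit:
  assumes \<alpha>: "0 < \<alpha>" "\<alpha> < real DIM('a::euclidean_space)"
    and pq: "1 < p" "p < q" "1 / p - 1 / q = \<alpha> / DIM('a)"
  obtains C where "0 < C" "\<And>f::'a \<Rightarrow> ennreal. f \<in> borel_measurable borel \<Longrightarrow>
      (\<integral>\<^sup>+z. enn_powr (f z) p \<partial>lborel) \<le> 1 \<Longrightarrow>
      (\<integral>\<^sup>+x. enn_powr (riesz_op \<alpha> f x) q \<partial>lborel) \<le> ennreal C"
proof -
  obtain C c where C: "0 < C" "0 < c" "\<And>(f::'a \<Rightarrow> ennreal) l. f \<in> borel_measurable borel \<Longrightarrow>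
      (\<integral>\<^sup>+z. enn_powr (f z) p \<partial>lborel) \<le> 1 \<Longrightarrow> 0 < l \<Longrightarrow>
      emeasure lborel {x. ennreal l < riesz_op \<alpha> f x} \<le>
        ennreal (C * l powr - (q / p)) * (\<integral>\<^sup>+z. (if ennreal (c * l powr (q / p)) < f z then f z else 0) \<partial>lborel)"
    using riesz_op_level[OF \<alpha> pq] by blast
  \<comment> \<open>theta - 1 is the exponent of l^{q-1} l^{-q/p}, and theta (p/q) = p - 1 is what
    turns f g^theta into a multiple of f^p.\<close>
  define \<theta> where "\<theta> = q - q / p"
  have q: "0 < q" and \<theta>: "0 < \<theta>" and \<theta>p: "\<theta> * (p / q) = p - 1"
    using pq by (auto simp: \<theta>_def field_simps)
  define E where "E = q * C / \<theta>"
  have E: "0 < E" using q C \<theta> by (simp add: E_def)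
  show thesis
  proof (rule that[of "E * c powr (1 - p)"])
    fix f :: "'a \<Rightarrow> ennreal"
    assume f [measurable]: "f \<in> borel_measurable borel" and le1: "(\<integral>\<^sup>+z. enn_powr (f z) p \<partial>lborel) \<le> 1"
    \<comment> \<open>The threshold c l^{q/p} < f z solved for l: it implies l < g z.\<close>
    define g where "g z = enn_powr (ennreal (1 / c) * f z) (p / q)" for z
    have g [measurable]: "g \<in> borel_measurable borel" unfolding g_def by measurable
    have less_g: "ennreal l < g z" if "ennreal (c * l powr (q / p)) < f z" "0 < l" for l z
    proof (cases "f z")
      case (real v)
      then have "l powr (q / p) < v / c" using that C by (simp add: ennreal_less_iff field_simps)
      then have "(l powr (q / p)) powr (p / q) < (v / c) powr (p / q)"
        using pq q by (intro powr_less_mono2) auto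
      then have "l < (v / c) powr (p / q)"
        using pq that by (simp add: powr_powr)
      then show ?thesis using real that C
        by (simp add: g_def enn_powr_ennreal ennreal_less_iff flip: ennreal_mult)
    qed (use C in \<open>simp add: g_def ennreal_mult_top\<close>)
    have "(\<integral>\<^sup>+x. enn_powr (riesz_op \<alpha> f x) q \<partial>lborel)
      = (\<integral>\<^sup>+x. (\<integral>\<^sup>+l. (if 0 < l \<and> ennreal l < riesz_op \<alpha> f x then ennreal (q * l powr (q - 1)) else 0) \<partial>lborel) \<partial>lborel)"
      by (simp add: enn_powr_layer_cake[OF q])
    also have "\<dots> = (\<integral>\<^sup>+l. (\<integral>\<^sup>+x. (if 0 < l \<and> ennreal l < riesz_op \<alpha> f x then ennreal (q * l powr (q - 1)) else 0) \<partial>lborel) \<partial>lborel)"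
      by (rule lborel_pair.Fubini'[symmetric]) measurable
    also have "\<dots> \<le> (\<integral>\<^sup>+l. (\<integral>\<^sup>+z. ennreal E * (f z * (if 0 < l \<and> ennreal l < g z then ennreal (\<theta> * l powr (\<theta> - 1)) else 0)) \<partial>lborel) \<partial>lborel)"
    proof (rule nn_integral_mono)
      fix l :: real
      show "(\<integral>\<^sup>+x. (if 0 < l \<and> ennreal l < riesz_op \<alpha> f x then ennreal (q * l powr (q - 1)) else 0) \<partial>lborel)
        \<le> (\<integral>\<^sup>+z. ennreal E * (f z * (if 0 < l \<and> ennreal l < g z then ennreal (\<theta> * l powr (\<theta> - 1)) else 0)) \<partial>lborel)"
      proof (cases "0 < l")
        case True
        have "(\<integral>\<^sup>+x. (if 0 < l \<and> ennreal l < riesz_op \<alpha> f x then ennreal (q * l powr (q - 1)) else 0) \<partial>lborel)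
          = (\<integral>\<^sup>+x. ennreal (q * l powr (q - 1)) * indicator {x. ennreal l < riesz_op \<alpha> f x} x \<partial>lborel)"
          using True by (intro nn_integral_cong) (auto simp: indicator_def)
        also have "\<dots> = ennreal (q * l powr (q - 1)) * emeasure lborel {x. ennreal l < riesz_op \<alpha> f x}"
          by (intro nn_integral_cmult_indicator) measurable
        also have "\<dots> \<le> ennreal (q * l powr (q - 1)) * (ennreal (C * l powr - (q / p))
            * (\<integral>\<^sup>+z. (if ennreal (c * l powr (q / p)) < f z then f z else 0) \<partial>lborel))"
          by (intro mult_left_mono C f le1 True) auto
        also have "\<dots> = ennreal (E * (\<theta> * l powr (\<theta> - 1))) * (\<integral>\<^sup>+z. (if ennreal (c * l powr (q / p)) < f z then f z else 0) \<partial>lborel)"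
        proof -
          have "q * l powr (q - 1) * (C * l powr - (q / p)) = q * C * (l powr (q - 1) * l powr - (q / p))"
            by simp
          also have "l powr (q - 1) * l powr - (q / p) = l powr (\<theta> - 1)"
            by (simp add: \<theta>_def algebra_simps flip: powr_add)
          also have "q * C * l powr (\<theta> - 1) = E * (\<theta> * l powr (\<theta> - 1))"
            using \<theta> by (simp add: E_def)
          finally show ?thesis
            using q C by (simp add: mult.assoc[symmetric] flip: ennreal_mult)
        qed
        also have "\<dots> = (\<integral>\<^sup>+z. ennreal (E * (\<theta> * l powr (\<theta> - 1))) * (if ennreal (c * l powr (q / p)) < f z then f z else 0) \<partial>lborel)"
          by (intro nn_integral_cmult[symmetric]) measurable
        also have "\<dots> \<le> (\<integral>\<^sup>+z. ennreal E * (f z * (if 0 < l \<and> ennreal l < g z then ennreal (\<theta> * l powr (\<theta> - 1)) else 0)) \<partial>lborel)"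
          using True less_g E \<theta> by (intro nn_integral_mono) (auto simp: ennreal_mult mult_ac)
        finally show ?thesis .
      qed simp
    qed
    also have "\<dots> = (\<integral>\<^sup>+z. (\<integral>\<^sup>+l. ennreal E * (f z * (if 0 < l \<and> ennreal l < g z then ennreal (\<theta> * l powr (\<theta> - 1)) else 0)) \<partial>lborel) \<partial>lborel)"
      by (rule lborel_pair.Fubini') measurable
    also have "\<dots> = (\<integral>\<^sup>+z. ennreal E * (f z * enn_powr (g z) \<theta>) \<partial>lborel)"
      by (simp add: nn_integral_cmult enn_powr_layer_cake[OF \<theta>])
    also have "\<dots> = (\<integral>\<^sup>+z. ennreal (E * c powr (1 - p)) * enn_powr (f z) p \<partial>lborel)"
    proof (rule nn_integral_cong)
      fix z
      have "f z * enn_powr (f z) (p - 1) = enn_powr (f z) p"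
        using enn_powr_add_exponent[of "f z" 1 "p - 1"] by simp
      moreover have "(1 / c) powr (p - 1) = c powr (1 - p)"
        using C powr_minus_divide[of c "p - 1"] by (simp add: powr_divide)
      moreover have "enn_powr (g z) \<theta> = enn_powr (ennreal (1 / c) * f z) (p - 1)"
        unfolding g_def enn_powr_powr \<theta>p[symmetric] by (simp only: mult.commute)
      ultimately have "f z * enn_powr (g z) \<theta> = ennreal (c powr (1 - p)) * enn_powr (f z) p"
        using C by (simp add: enn_powr_mult enn_powr_ennreal mult.left_commute[of "f z"])
      then show "ennreal E * (f z * enn_powr (g z) \<theta>) = ennreal (E * c powr (1 - p)) * enn_powr (f z) p"
        using E by (simp add: ennreal_mult mult.assoc)
    qed
    also have "\<dots> = ennreal (E * c powr (1 - p)) * (\<integral>\<^sup>+z. enn_powr (f z) p \<partial>lborel)"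
      by (intro nn_integral_cmult) measurable
    also have "\<dots> \<le> ennreal (E * c powr (1 - p)) * 1"
      by (intro mult_left_mono le1) auto
    finally show "(\<integral>\<^sup>+x. enn_powr (riesz_op \<alpha> f x) q \<partial>lborel) \<le> ennreal (E * c powr (1 - p))"
      by simp
  qed (use E C in auto)
qed

lemma riesz_op_cmult:
  fixes f :: "'a::euclidean_space \<Rightarrow> ennreal"
  assumes [measurable]: "f \<in> borel_measurable borel"
  shows "riesz_op \<alpha> (\<lambda>z. c * f z) x = c * riesz_op \<alpha> f x"
  unfolding riesz_op_def by (subst nn_integral_cmult[symmetric]) (auto simp: mult.left_commute)

text \<open>Homogeneity reduces to the unit case. The function is divided by an arbitrary finite c >
  0 above its norm, not by the norm, which may be 0 or infinite.\<close>

theorem hardy_littlewood_sobolev: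
  assumes \<alpha>: "0 < \<alpha>" "\<alpha> < real DIM('a::euclidean_space)"
    and pq: "1 < p" "p < q" "1 / p - 1 / q = \<alpha> / DIM('a)"
  obtains C where "0 < C" "\<And>f::'a \<Rightarrow> ennreal. f \<in> borel_measurable borel \<Longrightarrow>
      Lq_norm q (riesz_op \<alpha> f) \<le> ennreal C * Lq_norm p f"
proof -
  obtain C where C: "0 < C" "\<And>f::'a \<Rightarrow> ennreal. f \<in> borel_measurable borel \<Longrightarrow>
      (\<integral>\<^sup>+z. enn_powr (f z) p \<partial>lborel) \<le> 1 \<Longrightarrow>
      (\<integral>\<^sup>+x. enn_powr (riesz_op \<alpha> f x) q \<partial>lborel) \<le> ennreal C"
    using riesz_op_unit[OF \<alpha> pq] by blast
  have q: "0 < q" and p: "0 < p" using pq by auto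
  show thesis
  proof (rule that[of "C powr (1 / q)"])
    fix f :: "'a \<Rightarrow> ennreal" assume f [measurable]: "f \<in> borel_measurable borel"
    show "Lq_norm q (riesz_op \<alpha> f) \<le> ennreal (C powr (1 / q)) * Lq_norm p f"
    proof (rule ennreal_le_multI)
      fix c :: real assume c: "0 < c" and le: "Lq_norm p f \<le> ennreal c"
      define g where "g z = ennreal (1 / c) * f z" for z
      have g [measurable]: "g \<in> borel_measurable borel" unfolding g_def by measurable
      have "(\<integral>\<^sup>+z. enn_powr (f z) p \<partial>lborel) \<le> ennreal (c powr p)"
        using enn_powr_mono[OF le, of p] p c
        by (simp add: Lq_norm_def nn_integral_completion enn_powr_powr enn_powr_ennreal)
      then have "ennreal ((1 / c) powr p) * (\<integral>\<^sup>+z. enn_powr (f z) p \<partial>lborel) \<le> ennreal ((1 / c) powr p) * ennreal (c powr p)"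
        by (intro mult_left_mono) auto
      also have "\<dots> = 1" using c by (simp add: powr_divide flip: ennreal_mult)
      finally have "(\<integral>\<^sup>+z. enn_powr (g z) p \<partial>lborel) \<le> 1"
        using c by (simp add: g_def enn_powr_mult enn_powr_ennreal nn_integral_cmult)
      from C(2)[OF g this] have le_C: "(\<integral>\<^sup>+x. enn_powr (riesz_op \<alpha> g x) q \<partial>lborel) \<le> ennreal C" .
      have "f = (\<lambda>z. ennreal c * g z)"
        using c by (auto simp: g_def mult.assoc[symmetric] simp flip: ennreal_mult)
      then have "riesz_op \<alpha> f = (\<lambda>x. ennreal c * riesz_op \<alpha> g x)"
        using riesz_op_cmult[OF g, of \<alpha> "ennreal c"] by auto
      then have "Lq_norm q (riesz_op \<alpha> f) = enn_powr (ennreal (c powr q) * (\<integral>\<^sup>+x. enn_powr (riesz_op \<alpha> g x) q \<partial>lborel)) (1 / q)"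
        using c by (simp add: Lq_norm_def nn_integral_completion enn_powr_mult enn_powr_ennreal nn_integral_cmult)
      also have "\<dots> \<le> enn_powr (ennreal (c powr q) * ennreal C) (1 / q)"
        using q by (intro enn_powr_mono mult_left_mono le_C) auto
      also have "\<dots> = ennreal (C powr (1 / q) * c)"
        using c C q by (simp add: enn_powr_ennreal powr_mult powr_powr mult.commute flip: ennreal_mult)
      finally show "Lq_norm q (riesz_op \<alpha> f) \<le> ennreal (C powr (1 / q) * c)" .
    qed (use C in simp)
  qed (use C in simp)
qed

section \<open>The area function of a Riesz potential\<close>

text \<open>Put d = |x-w|. If d >= 4t, then |y-z| >= d - 2t >= d/2 on the ball. If d < 4t, the ball
  lies within distance t + 4t + t = 6t of y, the near estimate gives a multiple of t^alpha = t^n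
  t^{alpha-n}, and the negative exponent turns t > d/4 into t^{alpha-n} <= (d/4)^{alpha-n}.\<close>

lemma riesz_kernel_local:
  assumes \<alpha>: "0 < \<alpha>" "\<alpha> < real DIM('a::euclidean_space)"
  obtains C where "0 < C" "\<And>(x::'a) w y t. 0 < t \<Longrightarrow> x \<noteq> w \<Longrightarrow> dist x y < t \<Longrightarrow>
    (\<integral>\<^sup>+z. indicator (ball w t) z * riesz_kernel \<alpha> y z \<partial>lborel) \<le> ennreal (C * t ^ DIM('a)) * riesz_kernel \<alpha> x w"
proof -
  let ?n = "DIM('a)"
  obtain A where A: "0 < A" "\<And>(x::'a) R. 0 < R \<Longrightarrow>
    (\<integral>\<^sup>+z. indicator (ball x R) z * riesz_kernel \<alpha> x z \<partial>lborel) \<le> ennreal (A * R powr \<alpha>)"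
    using riesz_kernel_near[OF \<alpha>] by blast
  define V where "V = unit_ball_vol (real ?n)"
  have V: "0 < V" by (simp add: V_def)
  define C1 where "C1 = (1/2) powr (\<alpha> - ?n) * V"
  define C2 where "C2 = A * 6 powr \<alpha> * (1/4) powr (\<alpha> - ?n)"
  have C1: "0 < C1" and C2: "0 < C2" using A V by (auto simp: C1_def C2_def)
  show thesis
  proof (rule that[of "C1 + C2"])
    fix x w y :: 'a and t :: real
    assume t: "0 < t" and "x \<noteq> w" and y: "dist x y < t"
    define d where "d = dist x w"
    have d: "0 < d" using \<open>x \<noteq> w\<close> by (simp add: d_def)
    have K: "riesz_kernel \<alpha> x w = ennreal (d powr (\<alpha> - ?n))"
      by (simp add: riesz_kernel_def d_def dist_norm)
    have "(\<integral>\<^sup>+z. indicator (ball w t) z * riesz_kernel \<alpha> y z \<partial>lborel) \<le> ennreal ((C1 + C2) * t ^ ?n * d powr (\<alpha> - ?n))"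
    proof (cases "4 * t \<le> d")
      case True
      have "(\<integral>\<^sup>+z. indicator (ball w t) z * riesz_kernel \<alpha> y z \<partial>lborel)
        \<le> (\<integral>\<^sup>+z. ennreal ((d / 2) powr (\<alpha> - ?n)) * indicator (ball w t) z \<partial>lborel)"
      proof (rule nn_integral_mono)
        fix z
        show "indicator (ball w t) z * riesz_kernel \<alpha> y z \<le> ennreal ((d / 2) powr (\<alpha> - ?n)) * indicator (ball w t) z"
        proof (cases "z \<in> ball w t")
          case z: True
          have "d \<le> dist x y + dist y z + dist z w"
            unfolding d_def using dist_triangle[of x w y] dist_triangle[of y w z] by simp
          then have "d / 2 \<le> norm (y - z)"
            using z y True by (simp add: dist_norm norm_minus_commute)
          then show ?thesis using z d \<alpha> by (auto simp: riesz_kernel_def intro!: ennreal_leI powr_mono2')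
        qed simp
      qed
      also have "\<dots> = ennreal ((d / 2) powr (\<alpha> - ?n) * (V * t ^ ?n))"
        using t V by (simp add: nn_integral_cmult_indicator emeasure_ball V_def flip: ennreal_mult)
      also have "(d / 2) powr (\<alpha> - ?n) * (V * t ^ ?n) = C1 * t ^ ?n * d powr (\<alpha> - ?n)"
        using d by (simp add: C1_def powr_mult[of "1/2" d, simplified])
      also have "\<dots> \<le> (C1 + C2) * t ^ ?n * d powr (\<alpha> - ?n)"
        using C2 t by (intro mult_right_mono) auto
      finally show ?thesis by (simp add: ennreal_leI)
    next
      case False
      have "ball w t \<subseteq> ball y (6 * t)"
      proof
        fix z assume "z \<in> ball w t"
        moreover have "dist y z \<le> dist y x + dist x w + dist w z"
          using dist_triangle[of y z x] dist_triangle[of x z w] by simp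
        ultimately show "z \<in> ball y (6 * t)" using y False by (simp add: d_def dist_commute)
      qed
      then have "(\<integral>\<^sup>+z. indicator (ball w t) z * riesz_kernel \<alpha> y z \<partial>lborel)
        \<le> (\<integral>\<^sup>+z. indicator (ball y (6 * t)) z * riesz_kernel \<alpha> y z \<partial>lborel)"
        by (intro nn_integral_mono mult_right_mono) (auto simp: indicator_def)
      also have "\<dots> \<le> ennreal (A * (6 * t) powr \<alpha>)" using t by (intro A) simp
      also have "A * (6 * t) powr \<alpha> \<le> C2 * t ^ ?n * d powr (\<alpha> - ?n)"
      proof -
        have "t powr (\<alpha> - ?n) \<le> (d / 4) powr (\<alpha> - ?n)"
          using False d \<alpha> by (intro powr_mono2') auto
        also have "\<dots> = (1/4) powr (\<alpha> - ?n) * d powr (\<alpha> - ?n)"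
          using d by (simp add: powr_mult[of "1/4" d, simplified])
        finally have le: "t powr (\<alpha> - ?n) \<le> (1/4) powr (\<alpha> - ?n) * d powr (\<alpha> - ?n)" .
        have "A * (6 * t) powr \<alpha> = A * 6 powr \<alpha> * t ^ ?n * t powr (\<alpha> - ?n)"
          using t by (simp add: powr_mult powr_diff powr_realpow)
        also have "\<dots> \<le> A * 6 powr \<alpha> * t ^ ?n * ((1/4) powr (\<alpha> - ?n) * d powr (\<alpha> - ?n))"
          using A t by (intro mult_left_mono le) auto
        finally show ?thesis by (simp add: C2_def mult_ac)
      qed
      also have "\<dots> \<le> (C1 + C2) * t ^ ?n * d powr (\<alpha> - ?n)"
        using C1 t by (intro mult_right_mono) auto
      finally show ?thesis by (simp add: ennreal_leI)
    qed
    also have "\<dots> = ennreal ((C1 + C2) * t ^ ?n) * riesz_kernel \<alpha> x w"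
      unfolding K using C1 C2 t by (simp add: ennreal_mult)
    finally show "(\<integral>\<^sup>+z. indicator (ball w t) z * riesz_kernel \<alpha> y z \<partial>lborel) \<le> ennreal ((C1 + C2) * t ^ ?n) * riesz_kernel \<alpha> x w" .
  qed (use C1 C2 in auto)
qed

text \<open>The weight is the ennreal form of $b^{1-r}$, equal to infinity at $b = 0$ and to $0$ at
  $b = \infty$, so the degenerate values of $b$ need no separate treatment. Integrating this inequality
  and optimising over $s$ is how Minkowski's inequality is obtained below.\<close>

lemma ennreal_Young_weighted:
  assumes r: "1 < r" and s: "0 < s"
  shows "u \<le> ennreal (s powr (1 - r)) * (enn_powr u r * inverse (enn_powr b (r - 1))) + ennreal s * b"
proof (cases "b = 0 \<or> b = top")
  case True
  then show ?thesis
    using s by (cases "u = 0") (auto simp: ennreal_mult_top)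
next
  case False
  then obtain c where c: "b = ennreal c" "0 < c"
    by (cases b) (auto simp: less_le)
  have "u \<le> ennreal ((s * c) powr (1 - r)) * enn_powr u r + ennreal (s * c)"
    using r s c by (intro ennreal_le_powr_add) auto
  moreover have "inverse (enn_powr b (r - 1)) = ennreal (c powr (1 - r))"
    using c powr_minus[of c "r - 1"] by (simp add: enn_powr_ennreal inverse_ennreal)
  ultimately show ?thesis
    using s c by (simp add: powr_mult ennreal_mult mult_ac)
qed

text \<open>An equality for finite b; at infinity the left side is infinity * 0 = 0, hence only an
  inequality.\<close>

lemma enn_powr_mult_inverse_le: "enn_powr b r * inverse (enn_powr b (r - 1)) \<le> b"
proof (cases "b = 0 \<or> b = top")
  case False
  then obtain c where c: "b = ennreal c" "0 < c"
    by (cases b) (auto simp: less_le)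
  have "c powr r * c powr (1 - r) = c" using c by (simp flip: powr_add)
  moreover have "inverse (enn_powr b (r - 1)) = ennreal (c powr (1 - r))"
    using c powr_minus[of c "r - 1"] by (simp add: enn_powr_ennreal inverse_ennreal)
  ultimately show ?thesis
    using c by (simp add: enn_powr_ennreal flip: ennreal_mult)
qed auto

lemma enn_powr_le_optimise:
  assumes r: "1 < r" and c: "0 < c"
    and le: "\<And>s. 0 < s \<Longrightarrow> u \<le> ennreal (s powr (1 - r)) * X + ennreal (s * c)"
  shows "enn_powr u r \<le> ennreal (2 powr r * c powr (r - 1)) * X"
proof (rule ennreal_le_multI)
  fix e :: real assume e: "0 < e" and X: "X \<le> ennreal e"
  \<comment> \<open>Balances the two terms: s^r = e / c makes s^{1-r} e equal to s c, so u <= 2 s c,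
    whose r-th power is 2^r c^{r-1} e.\<close>
  define s where "s = (e / c) powr (1 / r)"
  have s: "0 < s" "s powr r = e / c" using e c r by (auto simp: s_def powr_powr)
  have se: "s powr (1 - r) * e = s * c"
    using s c e by (simp add: powr_diff)
  have "u \<le> ennreal (s powr (1 - r)) * X + ennreal (s * c)" by (rule le) fact
  also have "\<dots> \<le> ennreal (s powr (1 - r)) * ennreal e + ennreal (s * c)"
    by (intro add_mono mult_left_mono X) auto
  also have "\<dots> = ennreal (2 * (s * c))"
    using s c e by (simp add: se flip: ennreal_mult ennreal_plus)
  finally have "enn_powr u r \<le> enn_powr (ennreal (2 * (s * c))) r"
    using r by (intro enn_powr_mono) auto
  also have "\<dots> = ennreal (2 powr r * c powr (r - 1) * e)"
    using s c r by (simp add: enn_powr_ennreal powr_mult powr_diff mult_ac)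
  finally show "enn_powr u r \<le> ennreal (2 powr r * c powr (r - 1) * e)" .
qed (use c in auto)

section \<open>The area function and its pointwise domination\<close>

text \<open>A form over Borel measure with product integrands, suited to Tonelli's theorem and to
  \<open>measurable\<close>. The restriction to t > 0 is carried by the ball, which is empty
  otherwise.\<close>

lemma area_fun_alt:
  fixes F :: "'a::euclidean_space \<Rightarrow> real \<Rightarrow> ennreal"
  shows "area_fun r F x = enn_powr (\<integral>\<^sup>+t. (\<integral>\<^sup>+y. indicator (ball x t) y *
    (enn_powr (F y t) r * ennreal (1 / t ^ (DIM('a) + 1))) \<partial>lborel) \<partial>lborel) (1 / r)"
proof -
  have "enn_powr (F y t) r / ennreal (t ^ (DIM('a) + 1)) * indicator (ball x t) y
     = indicator (ball x t) y * (enn_powr (F y t) r * ennreal (1 / t ^ (DIM('a) + 1)))" if "0 < t" for t y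
    using that by (simp add: divide_ennreal_def inverse_ennreal inverse_eq_divide mult.commute)
  then have "(\<integral>\<^sup>+y. enn_powr (F y t) r / ennreal (t ^ (DIM('a) + 1)) * indicator (ball x t) y \<partial>lborel) * indicator {0<..} t
    = (\<integral>\<^sup>+y. indicator (ball x t) y * (enn_powr (F y t) r * ennreal (1 / t ^ (DIM('a) + 1))) \<partial>lborel)" for t
    by (cases "0 < t") (auto simp: ball_empty not_less)
  then show ?thesis
    by (simp add: area_fun_def nn_integral_completion)
qed

lemma borel_measurable_area_fun [measurable]:
  fixes F :: "'a::euclidean_space \<Rightarrow> real \<Rightarrow> ennreal"
  assumes [measurable]: "case_prod F \<in> borel_measurable (borel \<Otimes>\<^sub>M borel)"
  shows "area_fun r F \<in> borel_measurable borel"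
  unfolding area_fun_alt by measurable

text \<open>The two halves of the Schur argument are separate facts: \<open>J_le\<close> averages
  the kernel over z, \<open>X_le\<close> averages it over y, and each yields B times
  \<open>riesz_op \<alpha> a x\<close> or its finite bound c.\<close>

lemma area_fun_riesz_op_le:
  assumes \<alpha>: "0 < \<alpha>" "\<alpha> < real DIM('a::euclidean_space)" and r: "1 < r"
  obtains C where "0 < C" "\<And>(F::'a \<Rightarrow> real \<Rightarrow> ennreal) x. case_prod F \<in> borel_measurable (borel \<Otimes>\<^sub>M borel) \<Longrightarrow>
      area_fun r (\<lambda>y t. riesz_op \<alpha> (\<lambda>z. F z t) y) x \<le> ennreal C * riesz_op \<alpha> (area_fun r F) x"
proof -
  let ?n = "DIM('a)"
  obtain A where A: "0 < A" "\<And>(x::'a) w y t. 0 < t \<Longrightarrow> x \<noteq> w \<Longrightarrow> dist x y < t \<Longrightarrow>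
    (\<integral>\<^sup>+z. indicator (ball w t) z * riesz_kernel \<alpha> y z \<partial>lborel) \<le> ennreal (A * t ^ ?n) * riesz_kernel \<alpha> x w"
    using riesz_kernel_local[OF \<alpha>] by blast
  define V where "V = unit_ball_vol (real ?n)"
  have V: "0 < V" by (simp add: V_def)
  define B where "B = A / V"
  have B: "0 < B" using A V by (simp add: B_def)
  show thesis
  proof (rule that[of "2 * B"])
    fix F :: "'a \<Rightarrow> real \<Rightarrow> ennreal" and x :: 'a
    assume F [measurable]: "case_prod F \<in> borel_measurable (borel \<Otimes>\<^sub>M borel)"
    define a where "a = area_fun r F"
    have a [measurable]: "a \<in> borel_measurable borel" unfolding a_def by measurable
    \<comment> \<open>The Schur weight a^{1-r}. Since \<open>T w\<close> equals a(w)^r, the product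
      of T and this weight is at most a, which closes \<open>X_le\<close>; the other term of Young's
      inequality carries a(w) directly.\<close>
    define \<phi> where "\<phi> w = inverse (enn_powr (a w) (r - 1))" for w
    have \<phi> [measurable]: "\<phi> \<in> borel_measurable borel" unfolding \<phi>_def by measurable
    \<comment> \<open>The reciprocal volume of a ball of radius t. Against the t^n of the local
      kernel bound it leaves the constant B, independent of t.\<close>
    define v where "v t = ennreal (1 / (V * t ^ ?n))" for t :: real
    have v [measurable]: "v \<in> borel_measurable borel" unfolding v_def by measurable
    have vA: "v t * ennreal (A * t ^ ?n) = ennreal B" if "0 < t" for t
      using that A V by (simp add: v_def B_def flip: ennreal_mult)
    define u where "u t = ennreal (1 / t ^ (?n + 1))" for t :: real
    have u [measurable]: "u \<in> borel_measurable borel" unfolding u_def by measurable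
    define T where "T w = (\<integral>\<^sup>+t. (\<integral>\<^sup>+z. indicator (ball w t) z * (enn_powr (F z t) r * u t) \<partial>lborel) \<partial>lborel)" for w
    have T: "T w = enn_powr (a w) r" for w
      using r by (simp add: T_def a_def area_fun_alt u_def enn_powr_powr)
    have [measurable]: "T \<in> borel_measurable borel" unfolding T_def by measurable
    define J where "J y t = riesz_op \<alpha> (\<lambda>z. F z t) y" for y t
    \<comment> \<open>The term in F^r left by Young's inequality, without the parameter s, which is
      chosen only later and separately at each (y,t).\<close>
    define X where "X y t = (\<integral>\<^sup>+w. \<phi> w * (\<integral>\<^sup>+z. indicator (ball w t) z * (riesz_kernel \<alpha> y z * enn_powr (F z t) r) \<partial>lborel) \<partial>lborel)" for y t
    have [measurable]: "case_prod X \<in> borel_measurable (borel \<Otimes>\<^sub>M borel)" unfolding X_def by measurable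
    have AEx: "AE w in lborel. w \<noteq> x" by (rule AE_lborel_singleton)

    have J_le: "J y t \<le> ennreal (s powr (1 - r)) * (v t * X y t) + ennreal (s * (B * c))"
      if t: "0 < t" and y: "dist x y < t" and s: "0 < s" and c: "0 < c" "riesz_op \<alpha> a x \<le> ennreal c" for y t s c
    proof -
      have one: "v t * (\<integral>\<^sup>+w. indicator (ball w t) z \<partial>lborel) = 1" for z :: 'a
      proof -
        have "(\<integral>\<^sup>+w. indicator (ball w t) z \<partial>lborel) = (\<integral>\<^sup>+w. indicator (ball z t) w \<partial>lborel)"
          by (intro nn_integral_cong) (simp add: indicator_def dist_commute)
        then show ?thesis
          using t V by (simp add: emeasure_ball v_def V_def[symmetric] flip: ennreal_mult)
      qed
      have "J y t = (\<integral>\<^sup>+z. v t * (\<integral>\<^sup>+w. indicator (ball w t) z * (riesz_kernel \<alpha> y z * F z t) \<partial>lborel) \<partial>lborel)"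
        unfolding J_def riesz_op_def
        by (intro nn_integral_cong) (simp add: nn_integral_multc one mult.assoc[symmetric])
      also have "\<dots> = v t * (\<integral>\<^sup>+z. (\<integral>\<^sup>+w. indicator (ball w t) z * (riesz_kernel \<alpha> y z * F z t) \<partial>lborel) \<partial>lborel)"
        by (intro nn_integral_cmult) measurable
      also have "(\<integral>\<^sup>+z. (\<integral>\<^sup>+w. indicator (ball w t) z * (riesz_kernel \<alpha> y z * F z t) \<partial>lborel) \<partial>lborel)
        = (\<integral>\<^sup>+w. (\<integral>\<^sup>+z. indicator (ball w t) z * (riesz_kernel \<alpha> y z * F z t) \<partial>lborel) \<partial>lborel)"
        by (rule lborel_pair.Fubini') measurable
      also have "\<dots> \<le> (\<integral>\<^sup>+w. ennreal (s powr (1 - r)) * (\<phi> w * (\<integral>\<^sup>+z. indicator (ball w t) z * (riesz_kernel \<alpha> y z * enn_powr (F z t) r) \<partial>lborel))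
          + ennreal s * ennreal (A * t ^ ?n) * (riesz_kernel \<alpha> x w * a w) \<partial>lborel)"
      proof (rule nn_integral_mono_AE, use AEx in eventually_elim)
        fix w :: 'a assume "w \<noteq> x"
        have "(\<integral>\<^sup>+z. indicator (ball w t) z * (riesz_kernel \<alpha> y z * F z t) \<partial>lborel)
          \<le> (\<integral>\<^sup>+z. ennreal (s powr (1 - r)) * (\<phi> w * (indicator (ball w t) z * (riesz_kernel \<alpha> y z * enn_powr (F z t) r)))
             + ennreal s * a w * (indicator (ball w t) z * riesz_kernel \<alpha> y z) \<partial>lborel)"
        proof (rule nn_integral_mono)
          fix z
          have "indicator (ball w t) z * (riesz_kernel \<alpha> y z * F z t)
            \<le> indicator (ball w t) z * (riesz_kernel \<alpha> y z * (ennreal (s powr (1 - r)) * (enn_powr (F z t) r * \<phi> w) + ennreal s * a w))"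
            unfolding \<phi>_def by (intro mult_left_mono ennreal_Young_weighted r s) auto
          then show "indicator (ball w t) z * (riesz_kernel \<alpha> y z * F z t)
            \<le> ennreal (s powr (1 - r)) * (\<phi> w * (indicator (ball w t) z * (riesz_kernel \<alpha> y z * enn_powr (F z t) r)))
             + ennreal s * a w * (indicator (ball w t) z * riesz_kernel \<alpha> y z)"
            by (simp add: distrib_left mult_ac)
        qed
        also have "\<dots> = ennreal (s powr (1 - r)) * (\<phi> w * (\<integral>\<^sup>+z. indicator (ball w t) z * (riesz_kernel \<alpha> y z * enn_powr (F z t) r) \<partial>lborel))
             + ennreal s * a w * (\<integral>\<^sup>+z. indicator (ball w t) z * riesz_kernel \<alpha> y z \<partial>lborel)"
          by (simp add: nn_integral_add nn_integral_cmult)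
        also have "\<dots> \<le> ennreal (s powr (1 - r)) * (\<phi> w * (\<integral>\<^sup>+z. indicator (ball w t) z * (riesz_kernel \<alpha> y z * enn_powr (F z t) r) \<partial>lborel))
             + ennreal s * a w * (ennreal (A * t ^ ?n) * riesz_kernel \<alpha> x w)"
          using \<open>w \<noteq> x\<close> by (intro add_left_mono mult_left_mono A t y) auto
        finally show "(\<integral>\<^sup>+z. indicator (ball w t) z * (riesz_kernel \<alpha> y z * F z t) \<partial>lborel)
          \<le> ennreal (s powr (1 - r)) * (\<phi> w * (\<integral>\<^sup>+z. indicator (ball w t) z * (riesz_kernel \<alpha> y z * enn_powr (F z t) r) \<partial>lborel))
             + ennreal s * ennreal (A * t ^ ?n) * (riesz_kernel \<alpha> x w * a w)"
          by (simp only: mult_ac)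
      qed
      also have "\<dots> = ennreal (s powr (1 - r)) * X y t + ennreal s * ennreal (A * t ^ ?n) * riesz_op \<alpha> a x"
        unfolding X_def riesz_op_def by (subst nn_integral_add) (simp_all add: nn_integral_cmult)
      finally have "J y t \<le> v t * (ennreal (s powr (1 - r)) * X y t + ennreal s * ennreal (A * t ^ ?n) * riesz_op \<alpha> a x)"
        by (simp add: mult_left_mono)
      also have "\<dots> = ennreal (s powr (1 - r)) * (v t * X y t) + ennreal s * (v t * ennreal (A * t ^ ?n)) * riesz_op \<alpha> a x"
        by (simp only: distrib_left mult_ac)
      also have "\<dots> \<le> ennreal (s powr (1 - r)) * (v t * X y t) + ennreal s * ennreal B * ennreal c"
        unfolding vA[OF t] using c by (intro add_left_mono mult_left_mono) auto
      also have "ennreal s * ennreal B * ennreal c = ennreal (s * (B * c))"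
        using s B c by (simp add: mult.assoc flip: ennreal_mult)
      finally show ?thesis .
    qed

    \<comment> \<open>After integration over the cone the variable y is free to average the kernel.
      Tonelli's theorem brings w outermost, so that the remaining integral over t and z is the full
      cone integral \<open>T w\<close>.\<close>
    have X_le: "(\<integral>\<^sup>+t. (\<integral>\<^sup>+y. indicator (ball x t) y * (v t * X y t * u t) \<partial>lborel) \<partial>lborel) \<le> ennreal B * riesz_op \<alpha> a x"
    proof -
      have "(\<integral>\<^sup>+t. (\<integral>\<^sup>+y. indicator (ball x t) y * (v t * X y t * u t) \<partial>lborel) \<partial>lborel)
        \<le> (\<integral>\<^sup>+t. (\<integral>\<^sup>+w. ennreal B * (\<phi> w * riesz_kernel \<alpha> x w) * (\<integral>\<^sup>+z. indicator (ball w t) z * (enn_powr (F z t) r * u t) \<partial>lborel) \<partial>lborel) \<partial>lborel)"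
      proof (rule nn_integral_mono)
        fix t :: real
        show "(\<integral>\<^sup>+y. indicator (ball x t) y * (v t * X y t * u t) \<partial>lborel)
          \<le> (\<integral>\<^sup>+w. ennreal B * (\<phi> w * riesz_kernel \<alpha> x w) * (\<integral>\<^sup>+z. indicator (ball w t) z * (enn_powr (F z t) r * u t) \<partial>lborel) \<partial>lborel)"
        proof (cases "0 < t")
          case t: True
          have "(\<integral>\<^sup>+y. indicator (ball x t) y * (v t * X y t * u t) \<partial>lborel)
            = (\<integral>\<^sup>+y. (\<integral>\<^sup>+w. (\<integral>\<^sup>+z. indicator (ball x t) y * (v t * (\<phi> w * (indicator (ball w t) z * (riesz_kernel \<alpha> y z * enn_powr (F z t) r))) * u t) \<partial>lborel) \<partial>lborel) \<partial>lborel)"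
            unfolding X_def by (simp add: nn_integral_cmult nn_integral_multc)
          also have "\<dots> = (\<integral>\<^sup>+w. (\<integral>\<^sup>+y. (\<integral>\<^sup>+z. indicator (ball x t) y * (v t * (\<phi> w * (indicator (ball w t) z * (riesz_kernel \<alpha> y z * enn_powr (F z t) r))) * u t) \<partial>lborel) \<partial>lborel) \<partial>lborel)"
            by (rule lborel_pair.Fubini') measurable
          also have "\<dots> \<le> (\<integral>\<^sup>+w. ennreal B * (\<phi> w * riesz_kernel \<alpha> x w) * (\<integral>\<^sup>+z. indicator (ball w t) z * (enn_powr (F z t) r * u t) \<partial>lborel) \<partial>lborel)"
          proof (rule nn_integral_mono_AE, use AEx in eventually_elim)
            fix w :: 'a assume "w \<noteq> x"
            have "(\<integral>\<^sup>+y. (\<integral>\<^sup>+z. indicator (ball x t) y * (v t * (\<phi> w * (indicator (ball w t) z * (riesz_kernel \<alpha> y z * enn_powr (F z t) r))) * u t) \<partial>lborel) \<partial>lborel)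
              = (\<integral>\<^sup>+z. (\<integral>\<^sup>+y. indicator (ball x t) y * (v t * (\<phi> w * (indicator (ball w t) z * (riesz_kernel \<alpha> y z * enn_powr (F z t) r))) * u t) \<partial>lborel) \<partial>lborel)"
              by (rule lborel_pair.Fubini') measurable
            also have "\<dots> = (\<integral>\<^sup>+z. indicator (ball w t) z * (v t * \<phi> w * (enn_powr (F z t) r * u t)) * (\<integral>\<^sup>+y. indicator (ball x t) y * riesz_kernel \<alpha> z y \<partial>lborel) \<partial>lborel)"
              by (intro nn_integral_cong, subst nn_integral_cmult[symmetric])
                (auto simp: riesz_kernel_commute mult_ac intro!: nn_integral_cong)
            \<comment> \<open>The local kernel bound a second time, with the roles exchanged: z lies
              within t of w, and the average runs over y in the ball around x.\<close>
            also have "\<dots> \<le> (\<integral>\<^sup>+z. indicator (ball w t) z * (v t * \<phi> w * (enn_powr (F z t) r * u t)) * (ennreal (A * t ^ ?n) * riesz_kernel \<alpha> w x) \<partial>lborel)"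
            proof (rule nn_integral_mono)
              fix z
              show "indicator (ball w t) z * (v t * \<phi> w * (enn_powr (F z t) r * u t)) * (\<integral>\<^sup>+y. indicator (ball x t) y * riesz_kernel \<alpha> z y \<partial>lborel)
                \<le> indicator (ball w t) z * (v t * \<phi> w * (enn_powr (F z t) r * u t)) * (ennreal (A * t ^ ?n) * riesz_kernel \<alpha> w x)"
                using \<open>w \<noteq> x\<close> by (cases "z \<in> ball w t") (auto intro!: mult_left_mono A t)
            qed
            also have "\<dots> = (\<integral>\<^sup>+z. (v t * ennreal (A * t ^ ?n)) * (\<phi> w * riesz_kernel \<alpha> x w) * (indicator (ball w t) z * (enn_powr (F z t) r * u t)) \<partial>lborel)"
              by (simp only: riesz_kernel_commute[of \<alpha> w x] mult_ac)
            also have "\<dots> = ennreal B * (\<phi> w * riesz_kernel \<alpha> x w) * (\<integral>\<^sup>+z. indicator (ball w t) z * (enn_powr (F z t) r * u t) \<partial>lborel)"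
              unfolding vA[OF t] by (intro nn_integral_cmult) measurable
            finally show "(\<integral>\<^sup>+y. (\<integral>\<^sup>+z. indicator (ball x t) y * (v t * (\<phi> w * (indicator (ball w t) z * (riesz_kernel \<alpha> y z * enn_powr (F z t) r))) * u t) \<partial>lborel) \<partial>lborel)
              \<le> ennreal B * (\<phi> w * riesz_kernel \<alpha> x w) * (\<integral>\<^sup>+z. indicator (ball w t) z * (enn_powr (F z t) r * u t) \<partial>lborel)" .
          qed
          finally show ?thesis .
        qed (simp add: ball_empty not_less)
      qed
      also have "\<dots> = (\<integral>\<^sup>+w. (\<integral>\<^sup>+t. ennreal B * (\<phi> w * riesz_kernel \<alpha> x w) * (\<integral>\<^sup>+z. indicator (ball w t) z * (enn_powr (F z t) r * u t) \<partial>lborel) \<partial>lborel) \<partial>lborel)"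
        by (rule lborel_pair.Fubini') measurable
      also have "\<dots> = (\<integral>\<^sup>+w. ennreal B * (\<phi> w * riesz_kernel \<alpha> x w) * T w \<partial>lborel)"
        unfolding T_def by (intro nn_integral_cong nn_integral_cmult) measurable
      also have "\<dots> \<le> (\<integral>\<^sup>+w. ennreal B * (riesz_kernel \<alpha> x w * a w) \<partial>lborel)"
      proof (rule nn_integral_mono)
        fix w
        have "ennreal B * (riesz_kernel \<alpha> x w * (enn_powr (a w) r * \<phi> w)) \<le> ennreal B * (riesz_kernel \<alpha> x w * a w)"
          unfolding \<phi>_def by (intro mult_left_mono enn_powr_mult_inverse_le) auto
        then show "ennreal B * (\<phi> w * riesz_kernel \<alpha> x w) * T w \<le> ennreal B * (riesz_kernel \<alpha> x w * a w)"
          by (simp only: T mult_ac)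
      qed
      also have "\<dots> = ennreal B * riesz_op \<alpha> a x"
        unfolding riesz_op_def by (intro nn_integral_cmult) measurable
      finally show ?thesis .
    qed

    show "area_fun r (\<lambda>y t. riesz_op \<alpha> (\<lambda>z. F z t) y) x \<le> ennreal (2 * B) * riesz_op \<alpha> (area_fun r F) x"
      unfolding a_def[symmetric] J_def[symmetric]
    proof (rule ennreal_le_multI)
      fix c :: real assume c: "0 < c" "riesz_op \<alpha> a x \<le> ennreal c"
      have Bc: "0 < B * c" using B c by simp
      let ?D = "ennreal (2 powr r * (B * c) powr (r - 1))"
      have "(\<integral>\<^sup>+t. (\<integral>\<^sup>+y. indicator (ball x t) y * (enn_powr (J y t) r * u t) \<partial>lborel) \<partial>lborel)
        \<le> (\<integral>\<^sup>+t. (\<integral>\<^sup>+y. ?D * (indicator (ball x t) y * (v t * X y t * u t)) \<partial>lborel) \<partial>lborel)"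
      proof (intro nn_integral_mono)
        fix t :: real and y :: 'a
        show "indicator (ball x t) y * (enn_powr (J y t) r * u t) \<le> ?D * (indicator (ball x t) y * (v t * X y t * u t))"
        proof (cases "y \<in> ball x t")
          case True
          then have y: "dist x y < t" by simp
          then have t: "0 < t" using zero_le_dist[of x y] by linarith
          \<comment> \<open>Here s is optimised at the single point (y,t). The bound B c is the same
            for all points of the cone, so the resulting factor leaves the integral.\<close>
          have "enn_powr (J y t) r \<le> ?D * (v t * X y t)"
            by (rule enn_powr_le_optimise[OF r Bc J_le[OF t y _ c]])
          then have "enn_powr (J y t) r * u t \<le> ?D * (v t * X y t) * u t"
            by (intro mult_right_mono) auto
          then show ?thesis using True by (simp add: mult.assoc)
        qed simp
      qed
      also have "\<dots> = ?D * (\<integral>\<^sup>+t. (\<integral>\<^sup>+y. indicator (ball x t) y * (v t * X y t * u t) \<partial>lborel) \<partial>lborel)"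
        by (simp add: nn_integral_cmult)
      also have "\<dots> \<le> ?D * (ennreal B * riesz_op \<alpha> a x)"
        by (intro mult_left_mono X_le) auto
      also have "\<dots> \<le> ?D * (ennreal B * ennreal c)"
        by (intro mult_left_mono c) auto
      \<comment> \<open>2^r (B c)^{r-1} times B c; the factor 2 is the price of balancing the two
        terms.\<close>
      also have "\<dots> = ennreal ((2 * B * c) powr r)"
        using B c r Bc by (simp add: powr_mult[of 2 "B * c", simplified mult.assoc[symmetric]] powr_diff flip: ennreal_mult)
      finally have "area_fun r J x \<le> enn_powr (ennreal ((2 * B * c) powr r)) (1 / r)"
        unfolding area_fun_alt u_def[symmetric] using r by (intro enn_powr_mono) auto
      also have "\<dots> = ennreal (2 * B * c)"
        using B c r by (simp add: enn_powr_ennreal powr_powr)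
      finally show "area_fun r J x \<le> ennreal (2 * B * c)" .
    qed (use B in simp)
  qed (use B in simp)
qed

section \<open>Boundedness on tent spaces\<close>

lemma riesz_pot_le:
  fixes f g :: "'a::euclidean_space \<Rightarrow> real"
  assumes "AE z in lborel. f z = g z"
  shows "ennreal \<bar>riesz_pot \<alpha> f x\<bar> \<le> ennreal \<bar>1 / riesz_gamma TYPE('a) \<alpha>\<bar> * riesz_op \<alpha> (\<lambda>z. ennreal \<bar>g z\<bar>) x"
proof -
  let ?h = "\<lambda>z. f z / norm (x - z) powr (real DIM('a) - \<alpha>)"
  \<comment> \<open>If the integrand is not integrable, its Lebesgue integral has the default value
    0 and the bound is trivial.\<close>
  have "ennreal (norm (\<integral>z. ?h z \<partial>lebesgue)) \<le> (\<integral>\<^sup>+z. ennreal (norm (?h z)) \<partial>lebesgue)"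
  proof (cases "integrable lebesgue ?h")
    case True
    then show ?thesis by (rule integral_norm_bound_ennreal)
  qed (simp add: not_integrable_integral_eq)
  also have "\<dots> = (\<integral>\<^sup>+z. ennreal (norm (?h z)) \<partial>lborel)"
    by (rule nn_integral_completion)
  also have "\<dots> = riesz_op \<alpha> (\<lambda>z. ennreal \<bar>g z\<bar>) x"
    unfolding riesz_op_def
  proof (rule nn_integral_cong_AE, use assms in eventually_elim)
    fix z assume "f z = g z"
    moreover have "inverse (norm (x - z) powr (real DIM('a) - \<alpha>)) = norm (x - z) powr (\<alpha> - real DIM('a))"
      by (simp flip: powr_minus)
    ultimately show "ennreal (norm (?h z)) = riesz_kernel \<alpha> x z * ennreal \<bar>g z\<bar>"
      by (simp add: riesz_kernel_def divide_inverse abs_mult mult.commute flip: ennreal_mult)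
  qed
  finally have "ennreal \<bar>\<integral>z. ?h z \<partial>lebesgue\<bar> \<le> riesz_op \<alpha> (\<lambda>z. ennreal \<bar>g z\<bar>) x" by simp
  then show ?thesis
    unfolding riesz_pot_def abs_mult by (subst ennreal_mult) (auto intro: mult_left_mono)
qed

text \<open>Off the centre, the kernel is at least tau^{alpha-n} on the ball of radius tau, and
  |B|^{alpha/n-1} is a fixed multiple of that same power, so the bound is uniform in the
  radius.\<close>

lemma frac_max_le:
  fixes f g :: "'a::euclidean_space \<Rightarrow> real"
  assumes \<alpha>: "0 < \<alpha>" "\<alpha> < real DIM('a)" and ae: "AE z in lborel. f z = g z"
    and g [measurable]: "g \<in> borel_measurable borel"
  shows "frac_max \<alpha> f x \<le> ennreal (unit_ball_vol DIM('a) powr (\<alpha> / DIM('a) - 1)) * riesz_op \<alpha> (\<lambda>z. ennreal \<bar>g z\<bar>) x"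
  unfolding frac_max_def
proof (rule SUP_least)
  fix \<tau> :: real assume "\<tau> \<in> {0<..}"
  then have \<tau>: "0 < \<tau>" by simp
  let ?n = "DIM('a)"
  define V where "V = unit_ball_vol (real ?n)"
  have V: "0 < V" by (simp add: V_def)
  have meas: "measure lebesgue (ball x \<tau>) = V * \<tau> ^ ?n"
    using \<tau> by (simp add: content_ball V_def)
  have "(V * \<tau> ^ ?n) powr (\<alpha> / ?n) / (V * \<tau> ^ ?n) = (V * \<tau> ^ ?n) powr (\<alpha> / ?n - 1)"
    using V \<tau> by (simp add: powr_diff)
  also have "\<dots> = V powr (\<alpha> / ?n - 1) * \<tau> powr (?n * (\<alpha> / ?n - 1))"
    using V \<tau> by (simp add: powr_mult powr_powr flip: powr_realpow)
  also have "?n * (\<alpha> / ?n - 1) = \<alpha> - ?n"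
    by (simp add: field_simps)
  finally have eq: "(V * \<tau> ^ ?n) powr (\<alpha> / ?n) / (V * \<tau> ^ ?n) = V powr (\<alpha> / ?n - 1) * \<tau> powr (\<alpha> - ?n)" .
  have "ennreal (\<tau> powr (\<alpha> - ?n)) * (\<integral>\<^sup>+y\<in>ball x \<tau>. ennreal \<bar>f y\<bar> \<partial>lebesgue)
    = ennreal (\<tau> powr (\<alpha> - ?n)) * (\<integral>\<^sup>+y. ennreal \<bar>g y\<bar> * indicator (ball x \<tau>) y \<partial>lborel)"
    unfolding nn_integral_completion using ae by (intro arg_cong2[where f=times] nn_integral_cong_AE) auto
  also have "\<dots> = (\<integral>\<^sup>+y. ennreal (\<tau> powr (\<alpha> - ?n)) * (ennreal \<bar>g y\<bar> * indicator (ball x \<tau>) y) \<partial>lborel)"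
    by (intro nn_integral_cmult[symmetric]) measurable
  also have "\<dots> \<le> riesz_op \<alpha> (\<lambda>z. ennreal \<bar>g z\<bar>) x"
    unfolding riesz_op_def
  proof (rule nn_integral_mono_AE)
    show "AE y in lborel. ennreal (\<tau> powr (\<alpha> - ?n)) * (ennreal \<bar>g y\<bar> * indicator (ball x \<tau>) y) \<le> riesz_kernel \<alpha> x y * ennreal \<bar>g y\<bar>"
      using AE_lborel_singleton[of x]
    proof eventually_elim
      fix y assume "y \<noteq> x"
      then have "\<tau> powr (\<alpha> - ?n) \<le> norm (x - y) powr (\<alpha> - ?n)" if "y \<in> ball x \<tau>"
        using that \<alpha> by (intro powr_mono2') (auto simp: dist_norm)
      then show "ennreal (\<tau> powr (\<alpha> - ?n)) * (ennreal \<bar>g y\<bar> * indicator (ball x \<tau>) y) \<le> riesz_kernel \<alpha> x y * ennreal \<bar>g y\<bar>"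
        unfolding riesz_kernel_def by (cases "y \<in> ball x \<tau>") (auto intro!: mult_right_mono ennreal_leI)
    qed
  qed
  finally have "ennreal (V powr (\<alpha> / ?n - 1)) * (ennreal (\<tau> powr (\<alpha> - ?n)) * (\<integral>\<^sup>+y\<in>ball x \<tau>. ennreal \<bar>f y\<bar> \<partial>lebesgue))
    \<le> ennreal (V powr (\<alpha> / ?n - 1)) * riesz_op \<alpha> (\<lambda>z. ennreal \<bar>g z\<bar>) x"
    by (intro mult_left_mono) auto
  then show "ennreal (measure lebesgue (ball x \<tau>) powr (\<alpha> / ?n) / measure lebesgue (ball x \<tau>))
      * (\<integral>\<^sup>+ y\<in>ball x \<tau>. ennreal \<bar>f y\<bar> \<partial>lebesgue)
    \<le> ennreal (unit_ball_vol ?n powr (\<alpha> / ?n - 1)) * riesz_op \<alpha> (\<lambda>z. ennreal \<bar>g z\<bar>) x"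
    unfolding meas eq V_def[symmetric] by (simp add: ennreal_mult mult.assoc)
qed

text \<open>H is arbitrary, so that the Riesz potential and the maximal function can be inserted
  without a study of their joint measurability: the nonnegative integral is monotone on all
  functions, and measurability of G serves to pull out the constant.\<close>

lemma area_fun_le_cmult:
  fixes G H :: "'a::euclidean_space \<Rightarrow> real \<Rightarrow> ennreal"
  assumes [measurable]: "case_prod G \<in> borel_measurable (borel \<Otimes>\<^sub>M borel)" and r: "0 < r" and c: "0 \<le> c"
    and le: "AE t in lborel. \<forall>y. H y t \<le> ennreal c * G y t"
  shows "area_fun r H x \<le> ennreal c * area_fun r G x"
proof -
  have "(\<integral>\<^sup>+t. (\<integral>\<^sup>+y. indicator (ball x t) y * (enn_powr (H y t) r * ennreal (1 / t ^ (DIM('a) + 1))) \<partial>lborel) \<partial>lborel)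
    \<le> (\<integral>\<^sup>+t. (\<integral>\<^sup>+y. ennreal (c powr r) * (indicator (ball x t) y * (enn_powr (G y t) r * ennreal (1 / t ^ (DIM('a) + 1)))) \<partial>lborel) \<partial>lborel)"
  proof (rule nn_integral_mono_AE, use le in eventually_elim)
    fix t assume le: "\<forall>y. H y t \<le> ennreal c * G y t"
    show "(\<integral>\<^sup>+y. indicator (ball x t) y * (enn_powr (H y t) r * ennreal (1 / t ^ (DIM('a) + 1))) \<partial>lborel)
    \<le> (\<integral>\<^sup>+y. ennreal (c powr r) * (indicator (ball x t) y * (enn_powr (G y t) r * ennreal (1 / t ^ (DIM('a) + 1)))) \<partial>lborel)"
    proof (rule nn_integral_mono)
      fix y
      have "enn_powr (H y t) r \<le> enn_powr (ennreal c * G y t) r"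
        using le r by (intro enn_powr_mono) auto
      also have "\<dots> = ennreal (c powr r) * enn_powr (G y t) r"
        using c by (simp add: enn_powr_mult enn_powr_ennreal)
      finally have "indicator (ball x t) y * (enn_powr (H y t) r * ennreal (1 / t ^ (DIM('a) + 1)))
        \<le> indicator (ball x t) y * (ennreal (c powr r) * enn_powr (G y t) r * ennreal (1 / t ^ (DIM('a) + 1)))"
        by (intro mult_left_mono mult_right_mono) auto
      then show "indicator (ball x t) y * (enn_powr (H y t) r * ennreal (1 / t ^ (DIM('a) + 1)))
        \<le> ennreal (c powr r) * (indicator (ball x t) y * (enn_powr (G y t) r * ennreal (1 / t ^ (DIM('a) + 1))))"
        by (simp only: mult_ac)
    qed
  qed
  also have "\<dots> = ennreal (c powr r) * (\<integral>\<^sup>+t. (\<integral>\<^sup>+y. indicator (ball x t) y * (enn_powr (G y t) r * ennreal (1 / t ^ (DIM('a) + 1))) \<partial>lborel) \<partial>lborel)"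
    by (simp add: nn_integral_cmult)
  finally have "area_fun r H x \<le> enn_powr (ennreal (c powr r) * (\<integral>\<^sup>+t. (\<integral>\<^sup>+y. indicator (ball x t) y * (enn_powr (G y t) r * ennreal (1 / t ^ (DIM('a) + 1))) \<partial>lborel) \<partial>lborel)) (1 / r)"
    unfolding area_fun_alt using r by (intro enn_powr_mono) auto
  also have "\<dots> = ennreal c * area_fun r G x"
    unfolding area_fun_alt using c r by (simp add: enn_powr_mult enn_powr_ennreal powr_powr)
  finally show ?thesis .
qed

lemma Lq_norm_le_cmult:
  fixes g h :: "'a::euclidean_space \<Rightarrow> ennreal"
  assumes [measurable]: "g \<in> borel_measurable borel" and q: "0 < q" and c: "0 \<le> c"
    and le: "\<And>x. h x \<le> ennreal c * g x"
  shows "Lq_norm q h \<le> ennreal c * Lq_norm q g"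
proof -
  have "(\<integral>\<^sup>+x. enn_powr (h x) q \<partial>lborel) \<le> (\<integral>\<^sup>+x. enn_powr (ennreal c * g x) q \<partial>lborel)"
    using q by (intro nn_integral_mono enn_powr_mono le) auto
  also have "\<dots> = ennreal (c powr q) * (\<integral>\<^sup>+x. enn_powr (g x) q \<partial>lborel)"
    using c by (simp add: enn_powr_mult enn_powr_ennreal nn_integral_cmult)
  finally have "Lq_norm q h \<le> enn_powr (ennreal (c powr q) * (\<integral>\<^sup>+x. enn_powr (g x) q \<partial>lborel)) (1 / q)"
    unfolding Lq_norm_def nn_integral_completion using q by (intro enn_powr_mono) auto
  also have "\<dots> = ennreal c * Lq_norm q g"
    using c q by (simp add: Lq_norm_def nn_integral_completion enn_powr_mult enn_powr_ennreal powr_powr)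
  finally show ?thesis .
qed

section \<open>Passage from Lebesgue measurable functions to Borel representatives\<close>

lemma area_fun_cong_AE:
  assumes "AE t in lborel. AE y in lborel. F y t = G y t"
  shows "area_fun r F x = area_fun r G x"
  unfolding area_fun_alt
  by (intro arg_cong2[where f=enn_powr] refl nn_integral_cong_AE, use assms in eventually_elim)
    (auto intro!: nn_integral_cong_AE elim: eventually_mono)

text \<open>The operators act in y for fixed t, so the exceptional set must be sliced in this order:
  for almost every t, a null set of y.\<close>

lemma lebesgue_measurable_ex_borel_slices:
  fixes F :: "'a::euclidean_space \<Rightarrow> real \<Rightarrow> real"
  assumes "(\<lambda>yt. F (fst yt) (snd yt)) \<in> borel_measurable lebesgue"
  obtains G where "case_prod G \<in> borel_measurable (borel \<Otimes>\<^sub>M borel)"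
    "AE t in lborel. AE y in lborel. F y t = G y t"
proof -
  obtain g where g: "g \<in> borel_measurable lborel" "AE z in lborel. F (fst z) (snd z) = g z"
    using completion_ex_borel_measurable_real[OF assms] by blast
  from g(2) obtain N where N: "{z \<in> space lborel. F (fst z) (snd z) \<noteq> g z} \<subseteq> N" "N \<in> null_sets lborel"
    by (auto elim!: AE_E simp: null_sets_def)
  then have N': "N \<in> null_sets (lborel \<Otimes>\<^sub>M lborel)" by (simp add: lborel_prod)
  \<comment> \<open>Slicing the null set yields y first; the two quantifiers may be exchanged
    because the complement of N is measurable.\<close>
  have "AE y in lborel. AE t in lborel. (y, t) \<notin> N"
    using lborel_pair.AE_pair[OF AE_not_in[OF N']] by simp
  moreover have "{z \<in> space (lborel \<Otimes>\<^sub>M lborel). (fst z, snd z) \<notin> N} \<in> sets (lborel \<Otimes>\<^sub>M lborel)"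
    using sets.compl_sets[OF null_setsD2[OF N']] by (simp add: set_diff_eq del: sets_pair_measure)
  ultimately have "AE t in lborel. AE y in lborel. (y, t) \<notin> N"
    by (subst (asm) lborel_pair.AE_commute) auto
  moreover have "F y t = g (y, t)" if "(y, t) \<notin> N" for y t
    using subsetD[OF N(1), of "(y, t)"] that by auto
  ultimately have "AE t in lborel. AE y in lborel. F y t = g (y, t)"
    by (auto elim!: eventually_mono)
  moreover have "case_prod (\<lambda>y t. g (y, t)) \<in> borel_measurable (borel \<Otimes>\<^sub>M borel)"
    using g(1) by (simp add: borel_prod)
  ultimately show thesis using that by blast
qed

theorem theorem2p3:
  fixes \<alpha> r p q :: real
  assumes "0 < \<alpha>" "\<alpha> < real DIM('a::euclidean_space)"
    and "real DIM('a) / (real DIM('a) - \<alpha>) < r"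
    and "1 < p" "p < q" "1 / p - 1 / q = \<alpha> / real DIM('a)"
  shows "\<exists>C::real. C > 0 \<and>
    (\<forall>F :: 'a \<Rightarrow> real \<Rightarrow> real.
       (\<lambda>yt. F (fst yt) (snd yt)) \<in> borel_measurable lebesgue \<longrightarrow>
       Lq_norm p (area_fun r (\<lambda>y t. ennreal \<bar>F y t\<bar>)) < \<infinity> \<longrightarrow>
       Lq_norm q (area_fun r (\<lambda>y t. ennreal \<bar>riesz_pot \<alpha> (\<lambda>z. F z t) y\<bar>))
       + Lq_norm q (area_fun r (\<lambda>y t. frac_max \<alpha> (\<lambda>z. F z t) y))
       \<le> ennreal C * Lq_norm p (area_fun r (\<lambda>y t. ennreal \<bar>F y t\<bar>)))"
proof -
  have "1 < real DIM('a) / (real DIM('a) - \<alpha>)" using assms(1,2) by simp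
  then have r: "1 < r" using assms(3) by linarith
  have q: "0 < q" using assms by simp
  obtain A where A: "0 < A" "\<And>(F::'a \<Rightarrow> real \<Rightarrow> ennreal) x. case_prod F \<in> borel_measurable (borel \<Otimes>\<^sub>M borel) \<Longrightarrow>
      area_fun r (\<lambda>y t. riesz_op \<alpha> (\<lambda>z. F z t) y) x \<le> ennreal A * riesz_op \<alpha> (area_fun r F) x"
    using area_fun_riesz_op_le[OF assms(1,2) r] by blast
  obtain B where B: "0 < B" "\<And>f::'a \<Rightarrow> ennreal. f \<in> borel_measurable borel \<Longrightarrow>
      Lq_norm q (riesz_op \<alpha> f) \<le> ennreal B * Lq_norm p f"
    using hardy_littlewood_sobolev[OF assms(1,2,4-6)] by blast
  \<comment> \<open>The absolute value avoids determining the sign of the Gamma factors. Only k >= 0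
    is recorded; positivity of the final constant comes from m.\<close>
  define k where "k = \<bar>1 / riesz_gamma TYPE('a) \<alpha>\<bar>"
  define m where "m = unit_ball_vol DIM('a) powr (\<alpha> / DIM('a) - 1)"
  have k: "0 \<le> k" and m: "0 < m"
    using unit_ball_vol_pos[of "real DIM('a)"] by (simp_all add: k_def m_def del: unit_ball_vol_pos)
  show ?thesis
  proof (intro exI conjI allI impI)
    show "0 < (k + m) * (A * B)" using A B k m by (simp add: add_nonneg_pos)
    fix F :: "'a \<Rightarrow> real \<Rightarrow> real"
    assume "(\<lambda>yt. F (fst yt) (snd yt)) \<in> borel_measurable lebesgue"
    then obtain G where G [measurable]: "case_prod G \<in> borel_measurable (borel \<Otimes>\<^sub>M borel)"
      and ae: "AE t in lborel. AE y in lborel. F y t = G y t"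
      using lebesgue_measurable_ex_borel_slices by blast
    define J where "J y t = riesz_op \<alpha> (\<lambda>z. ennreal \<bar>G z t\<bar>) y" for y t
    have J [measurable]: "case_prod J \<in> borel_measurable (borel \<Otimes>\<^sub>M borel)"
      unfolding J_def riesz_op_def by measurable
    define a where "a = area_fun r (\<lambda>y t. ennreal \<bar>G y t\<bar>)"
    have a [measurable]: "a \<in> borel_measurable borel" unfolding a_def by measurable
    have a_eq: "area_fun r (\<lambda>y t. ennreal \<bar>F y t\<bar>) = a"
      unfolding a_def by (intro ext area_fun_cong_AE, use ae in eventually_elim) (auto elim: eventually_mono)
    have "Lq_norm q (area_fun r J) \<le> ennreal A * Lq_norm q (riesz_op \<alpha> a)"
      unfolding J_def a_def using q A(1) by (intro Lq_norm_le_cmult A(2)) auto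
    also have "\<dots> \<le> ennreal A * (ennreal B * Lq_norm p a)"
      by (intro mult_left_mono B a) auto
    finally have J_le: "Lq_norm q (area_fun r J) \<le> ennreal (A * B) * Lq_norm p a"
      using A B by (simp add: ennreal_mult mult.assoc)
    have "Lq_norm q (area_fun r (\<lambda>y t. ennreal \<bar>riesz_pot \<alpha> (\<lambda>z. F z t) y\<bar>)) \<le> ennreal k * Lq_norm q (area_fun r J)"
    proof (intro Lq_norm_le_cmult area_fun_le_cmult)
      \<comment> \<open>For a good t the slices agree almost everywhere in z, and the operators see
        the slice only through integrals in z, so the bound holds at every y.\<close>
      show "AE t in lborel. \<forall>y. ennreal \<bar>riesz_pot \<alpha> (\<lambda>z. F z t) y\<bar> \<le> ennreal k * J y t"
        using ae unfolding J_def k_def by eventually_elim (intro allI riesz_pot_le)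
    qed (use q r k in auto)
    moreover have "Lq_norm q (area_fun r (\<lambda>y t. frac_max \<alpha> (\<lambda>z. F z t) y)) \<le> ennreal m * Lq_norm q (area_fun r J)"
    proof (intro Lq_norm_le_cmult area_fun_le_cmult)
      show "AE t in lborel. \<forall>y. frac_max \<alpha> (\<lambda>z. F z t) y \<le> ennreal m * J y t"
        using ae by eventually_elim (auto simp: J_def m_def intro!: frac_max_le assms)
    qed (use q r m in auto)
    ultimately have "Lq_norm q (area_fun r (\<lambda>y t. ennreal \<bar>riesz_pot \<alpha> (\<lambda>z. F z t) y\<bar>))
       + Lq_norm q (area_fun r (\<lambda>y t. frac_max \<alpha> (\<lambda>z. F z t) y))
       \<le> ennreal k * Lq_norm q (area_fun r J) + ennreal m * Lq_norm q (area_fun r J)"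
      by (rule add_mono)
    also have "\<dots> = ennreal (k + m) * Lq_norm q (area_fun r J)"
      using k m by (simp add: distrib_right)
    also have "\<dots> \<le> ennreal (k + m) * (ennreal (A * B) * Lq_norm p a)"
      by (intro mult_left_mono J_le) auto
    also have "\<dots> = ennreal ((k + m) * (A * B)) * Lq_norm p a"
      using k m A B by (simp add: ennreal_mult mult.assoc)
    finally show "Lq_norm q (area_fun r (\<lambda>y t. ennreal \<bar>riesz_pot \<alpha> (\<lambda>z. F z t) y\<bar>))
       + Lq_norm q (area_fun r (\<lambda>y t. frac_max \<alpha> (\<lambda>z. F z t) y))
       \<le> ennreal ((k + m) * (A * B)) * Lq_norm p (area_fun r (\<lambda>y t. ennreal \<bar>F y t\<bar>))"
      unfolding a_eq .
  qed
qed

end
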